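(* Let $H:\mathbb{R}^n\times\mathbb{R}^n\to\mathbb{R}$ satisfy: $p\mapsto H(x,p)$ is convex for every $x\in\mathbb{R}^n$; $x\mapsto H(x,p)$ is concave for every $p\in\mathbb{R}^n$; and $|H(x,p)|\leqslant M(1+|x|)(1+|p|)$ for all $x,p\in\mathbb{R}^n$ and some $M\geqslant0$. If an initial function $g_0:\mathbb{R}^n\to\mathbb{R}$ is convex, then the unique forward viscosity solution $u:[0,\infty)\times\mathbb{R}^n\to\mathbb{R}$ of $\nabla_tu+H(x,\nabla_xu)=0$ satisfying $u(0,\cdot)=g_0(\cdot)$ is a bilateral viscosity solution. Consequently, every convex initial function is reconstructible in every time $T>0$.
   Context: For continuous $u$ and an interior point $(t,x)$, $\partial_+u(t,x)$ (resp. $\partial_-u(t,x)$) is the set of $\nabla\varphi(t,x)$ over $C^1$ functions $\varphi$ such that $u-\varphi$ has a local max (resp. min) at $(t,x)$. $u$ is a forward viscosity solution if at every interior point $u_t+H(x,u_x)\leqslant0$ for $(u_t,u_x)\in\partial_+u$ and $\geqslant0$ for $(u_t,u_x)\in\partial_-u$; $w$ is a backward viscosity solution if $w_t+H(x,w_x)\geqslant0$ on $\partial_+w$ and $\leqslant0$ on $\partial_-w$; a bilateral viscosity solution is one that is both forward and backward. $g_0\in C(\mathbb{R}^n,\mathbb{R})$ is reconstructible in time $T$ if $g_0=w(0,\cdot)$ where $w$ is the unique backward viscosity solution on $[0,T]\times\mathbb{R}^n$ with $w(T,\cdot)=u(T,\cdot)$ and $u$ is the unique forward viscosity solution on $[0,T]\times\mathbb{R}^n$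 with $u(0,\cdot)=g_0$. *)

theory Defs
  imports "HOL-Analysis.Analysis"
begin

text \<open>Points of space-time are pairs (t,x) :: real \<times> real^'n.
  A C^1 test function is a function phi on all of space-time with a continuous
  gradient field G; its gradient at z is G z = (d/dt, nabla_x).\<close>

definition C1_with_grad :: "(real \<times> 'a::euclidean_space \<Rightarrow> real) \<Rightarrow> (real \<times> 'a \<Rightarrow> real \<times> 'a) \<Rightarrow> bool" where
  "C1_with_grad \<phi> G \<longleftrightarrow> continuous_on UNIV G \<and> (\<forall>z. (\<phi> has_derivative (\<lambda>h. G z \<bullet> h)) (at z))"

definition superdiff :: "(real \<times> 'a::euclidean_space \<Rightarrow> real) \<Rightarrow> real \<times> 'a \<Rightarrow> (real \<times> 'a) set" where
  "superdiff U z = {G z | \<phi> G. C1_with_grad \<phi> G \<and>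
       (\<exists>e>0. \<forall>y\<in>ball z e. U y - \<phi> y \<le> U z - \<phi> z)}"

definition subdiff :: "(real \<times> 'a::euclidean_space \<Rightarrow> real) \<Rightarrow> real \<times> 'a \<Rightarrow> (real \<times> 'a) set" where
  "subdiff U z = {G z | \<phi> G. C1_with_grad \<phi> G \<and>
       (\<exists>e>0. \<forall>y\<in>ball z e. U y - \<phi> y \<ge> U z - \<phi> z)}"

definition forward_visc :: "('a::euclidean_space \<Rightarrow> 'a \<Rightarrow> real) \<Rightarrow> (real \<times> 'a) set \<Rightarrow> (real \<times> 'a) set
    \<Rightarrow> (real \<Rightarrow> 'a \<Rightarrow> real) \<Rightarrow> bool" where
  "forward_visc H S D u \<longleftrightarrow> continuous_on S (\<lambda>z. u (fst z) (snd z)) \<and>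
     (\<forall>z\<in>D. (\<forall>g\<in>superdiff (\<lambda>z. u (fst z) (snd z)) z. fst g + H (snd z) (snd g) \<le> 0) \<and>
             (\<forall>g\<in>subdiff (\<lambda>z. u (fst z) (snd z)) z. fst g + H (snd z) (snd g) \<ge> 0))"

definition backward_visc :: "('a::euclidean_space \<Rightarrow> 'a \<Rightarrow> real) \<Rightarrow> (real \<times> 'a) set \<Rightarrow> (real \<times> 'a) set
    \<Rightarrow> (real \<Rightarrow> 'a \<Rightarrow> real) \<Rightarrow> bool" where
  "backward_visc H S D w \<longleftrightarrow> continuous_on S (\<lambda>z. w (fst z) (snd z)) \<and>
     (\<forall>z\<in>D. (\<forall>g\<in>superdiff (\<lambda>z. w (fst z) (snd z)) z. fst g + H (snd z) (snd g) \<ge> 0) \<and>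
             (\<forall>g\<in>subdiff (\<lambda>z. w (fst z) (snd z)) z. fst g + H (snd z) (snd g) \<le> 0))"

definition bilateral_visc where
  "bilateral_visc H S D u \<longleftrightarrow> forward_visc H S D u \<and> backward_visc H S D u"

abbreviation fwd_T where "fwd_T H T u \<equiv> forward_visc H ({0..T} \<times> UNIV) ({0<..<T} \<times> UNIV) u"
abbreviation bwd_T where "bwd_T H T w \<equiv> backward_visc H ({0..T} \<times> UNIV) ({0<..<T} \<times> UNIV) w"

abbreviation fwd_inf where "fwd_inf H u \<equiv> forward_visc H ({0..} \<times> UNIV) ({0<..} \<times> UNIV) u"
abbreviation bil_inf where "bil_inf H u \<equiv> bilateral_visc H ({0..} \<times> UNIV) ({0<..} \<times> UNIV) u"

definition reconstructible where
  "reconstructible H T g0 \<longleftrightarrow>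
     (\<exists>u w. fwd_T H T u \<and> u 0 = g0 \<and>
            (\<forall>v. fwd_T H T v \<and> v 0 = g0 \<longrightarrow> (\<forall>t\<in>{0..T}. v t = u t)) \<and>
            bwd_T H T w \<and> w T = u T \<and>
            (\<forall>v. bwd_T H T v \<and> v T = u T \<longrightarrow> (\<forall>t\<in>{0..T}. v t = w t)) \<and>
            w 0 = g0)"

end

theory Submission
  imports Defs "HOL-Complex_Analysis.Great_Picard"
begin

text \<open>
  Uniqueness is a comparison principle without growth conditions: convexity in \<open>p\<close>, concavity in \<open>x\<close>
  and the growth bound make \<open>H\<close> Lipschitz in \<open>p\<close> with constant \<open>M (1 + norm x)\<close> and in \<open>x\<close> with constant
  \<open>M (1 + norm p)\<close>, so information travels with at most linearly growing speed. The backward problem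
  reduces to the forward one because \<open>- w (T - t)\<close> solves the equation for \<open>H x (- p)\<close>, which
  satisfies the same hypotheses.

  For existence, the epigraph of the Lagrangian depends jointly convexly on the position and the velocity, so the
  Lax--Oleinik step of size \<open>h\<close> preserves convexity. Its iterates are locally equi-Lipschitz, and a limit
  \<open>u\<close> as \<open>h\<close> tends to 0 is convex in \<open>x\<close> and satisfies, for every \<open>p\<close>,
  \<open>u (t + s) x = u t y + p \<bullet> (x - y) - s H x p + O(s\<^sup>2)\<close> up to taking the infimum (for \<open>\<ge>\<close>) or the
  supremum (for \<open>\<le>\<close>) over \<open>norm (y - x) = O(s)\<close>. Applied from time \<open>t - s\<close> this is the forward viscosity
  property. At a superdifferential \<open>(q, p)\<close> convexity makes \<open>p\<close> a global subgradient of \<open>u t\<close>, and the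
  lower estimate from time \<open>t\<close> gives \<open>q + H x p \<ge> 0\<close>; on subdifferentials \<open>q + H x p \<le> 0\<close>
  is the theorem of Barron and Jensen.
\<close>

section \<open>Convex functions\<close>

text \<open>Separates the point of the graph from the strict epigraph. Since \<open>f\<close> is
  finite on the whole space, the hyperplane is not vertical, and dividing by its last coefficient
  \<open>k\<close> gives the slope.\<close>

lemma convex_subgradient_exists:
  fixes f :: "'a::euclidean_space \<Rightarrow> real"
  assumes "convex_on UNIV f"
  obtains v where "\<And>y. f x + v \<bullet> (y - x) \<le> f y"
proof -
  let ?T = "{z. f (fst z) < snd z}"
  have cT: "convex ?T"
    unfolding convex_alt
  proof (intro ballI allI impI, clarsimp)
    fix a b c d and u :: real
    assume "f a < b" "f c < d" "0 \<le> u" "u \<le> 1"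
    have "f ((1 - u) *\<^sub>R a + u *\<^sub>R c) \<le> (1 - u) * f a + u * f c"
      using convex_onD[OF assms \<open>0 \<le> u\<close> \<open>u \<le> 1\<close>] by simp
    also have "\<dots> < (1 - u) * b + u * d"
    proof (cases "u = 0")
      case True then show ?thesis using \<open>f a < b\<close> by simp
    next
      case False
      then have "u * f c < u * d" "(1 - u) * f a \<le> (1 - u) * b"
        using \<open>f a < b\<close> \<open>f c < d\<close> \<open>0 \<le> u\<close> \<open>u \<le> 1\<close> by (auto intro!: mult_left_mono)
      then show ?thesis by simp
    qed
    finally show "f ((1 - u) *\<^sub>R a + u *\<^sub>R c) < (1 - u) * b + u * d" .
  qed
  have "(x, f x + 1) \<in> ?T" by simp
  then have neT: "?T \<noteq> {}" by blast
  have disj: "{(x, f x)} \<inter> ?T = {}" by auto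
  from separating_hyperplane_sets[OF convex_singleton cT _ neT disj]
  obtain a b where ab0: "a \<noteq> 0" and 1: "inner a (x, f x) \<le> b" and 2: "\<forall>z\<in>?T. b \<le> inner a z"
    by auto
  obtain c k where a: "a = (c, k)" by (cases a)
  have key: "c \<bullet> x + k * f x \<le> c \<bullet> y + k * r" if "f y < r" for y r
    using 1 2 that by (force simp: a)
  have k0: "k \<ge> 0"
    using key[of x "f x + 1"] by (simp add: algebra_simps)
  have "k \<noteq> 0"
  \<comment> \<open>A vertical hyperplane would bound \<open>c \<bullet> y\<close> below for all
    \<open>y\<close>, which the point \<open>x - c\<close> refutes.\<close>
  proof
    assume k: "k = 0"
    have "c \<bullet> x \<le> c \<bullet> y" for y using key[of y "f y + 1"] k by simp
    from this[of "x - c"] have "c \<bullet> c \<le> 0" by (simp add: inner_diff_right)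
    then have "c = 0" by (metis inner_ge_zero inner_eq_zero_iff order_antisym)
    with k a ab0 show False by (simp add: zero_prod_def)
  qed
  with k0 have k: "k > 0" by simp
  have "f x + (- (1/k) *\<^sub>R c) \<bullet> (y - x) \<le> f y" for y
  proof (rule field_le_epsilon)
    fix e :: real assume "e > 0"
    then have "c \<bullet> x + k * f x \<le> c \<bullet> y + k * (f y + e)" using key by simp
    then show "f x + (- (1/k) *\<^sub>R c) \<bullet> (y - x) \<le> f y + e"
      using k by (simp add: field_simps inner_diff_right)
  qed
  then show ?thesis using that by blast
qed

text \<open>If the slope exceeded \<open>K\<close>, the affine function would overtake the bound far
  out along \<open>v\<close>. Applied to subgradients of functions of linear growth and to the
  velocities in \<open>cost_epi\<close>.\<close>

lemma affine_minorant_slope_le: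
  fixes v :: "'a::real_inner"
  assumes minorant: "\<And>y. a + v \<bullet> y \<le> K * (1 + norm y)" and K: "K \<ge> 0"
  shows "norm v \<le> K"
proof (rule ccontr)
  assume "\<not> norm v \<le> K"
  then have vK: "norm v > K" by simp
  define D where "D = norm v * (norm v - K)"
  have D: "D > 0" unfolding D_def using vK K by (intro mult_pos_pos) auto
  \<comment> \<open>Chosen so that \<open>c * D\<close> is strictly larger than
    \<open>K - a\<close>.\<close>
  define c where "c = (\<bar>K - a\<bar> + 1) / D"
  have c: "c > 0" unfolding c_def using D by (intro divide_pos_pos) auto
  have "a + c * (norm v)\<^sup>2 \<le> K * (1 + c * norm v)"
    using minorant[of "c *\<^sub>R v"] c by (simp add: power2_norm_eq_inner)
  then have "c * D \<le> K - a" unfolding D_def by (simp add: algebra_simps power2_eq_square)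
  moreover have "c * D = \<bar>K - a\<bar> + 1" unfolding c_def using D by simp
  ultimately show False by simp
qed

text \<open>Every subgradient is the slope of an affine minorant of \<open>K * (1 + norm y)\<close>,
  hence has norm at most \<open>K\<close>; so the growth constant is itself a global Lipschitz
  constant.\<close>

lemma convex_linear_growth_Lipschitz:
  fixes f :: "'a::euclidean_space \<Rightarrow> real"
  assumes "convex_on UNIV f" and growth: "\<And>y. \<bar>f y\<bar> \<le> K * (1 + norm y)"
  shows "\<bar>f x - f y\<bar> \<le> K * norm (x - y)"
proof -
  have *: "f x - f y \<le> K * norm (x - y)" for x y
  proof -
    obtain v where v: "\<And>y. f x + v \<bullet> (y - x) \<le> f y"
      using convex_subgradient_exists[OF assms(1)] by blast
    have "(f x - v \<bullet> x) + v \<bullet> y \<le> K * (1 + norm y)" for y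
      using v[of y] growth[of y] by (simp add: inner_diff_right)
    moreover have "K \<ge> 0" using growth[of 0] by simp
    ultimately have "norm v \<le> K" by (rule affine_minorant_slope_le)
    have "f x - f y \<le> v \<bullet> (x - y)" using v[of y] by (simp add: inner_diff_right)
    also have "\<dots> \<le> norm v * norm (x - y)" by (rule norm_cauchy_schwarz)
    also have "\<dots> \<le> K * norm (x - y)"
      by (intro mult_right_mono \<open>norm v \<le> K\<close>) auto
    finally show ?thesis .
  qed
  show ?thesis using *[of x y] *[of y x] by (simp add: norm_minus_commute abs_le_iff)
qed

text \<open>A unit step from \<open>x\<close> in the direction of a subgradient \<open>v\<close>
  raises \<open>f\<close> by at least \<open>norm v\<close> and stays in the ball of radius
  \<open>R + 1\<close>, where \<open>f\<close> oscillates by at most \<open>2 * B\<close>.\<close>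

lemma convex_bounded_Lipschitz:
  fixes f :: "'a::euclidean_space \<Rightarrow> real"
  assumes "convex_on UNIV f" and bdd: "\<And>y. norm y \<le> R + 1 \<Longrightarrow> \<bar>f y\<bar> \<le> B"
    and "norm x \<le> R" "norm y \<le> R"
  shows "\<bar>f x - f y\<bar> \<le> 2 * B * norm (x - y)"
proof -
  have *: "f x - f y \<le> 2 * B * norm (x - y)" if x: "norm x \<le> R" for x y
  proof -
    obtain v where v: "\<And>y. f x + v \<bullet> (y - x) \<le> f y"
      using convex_subgradient_exists[OF assms(1)] by blast
    have "norm v \<le> 2 * B"
    proof (cases "v = 0")
      case True
      then show ?thesis using bdd[of x] x by simp
    next
      case False
      have "f x + norm v \<le> f (x + (1 / norm v) *\<^sub>R v)"
        using v[of "x + (1 / norm v) *\<^sub>R v"] False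
        by (simp add: power2_norm_eq_inner[symmetric] power2_eq_square)
      moreover have "norm (x + (1 / norm v) *\<^sub>R v) \<le> R + 1"
        using norm_triangle_ineq[of x "(1 / norm v) *\<^sub>R v"] x False by simp
      ultimately show ?thesis using bdd[of x] bdd[of "x + (1 / norm v) *\<^sub>R v"] x by linarith
    qed
    have "f x - f y \<le> v \<bullet> (x - y)" using v[of y] by (simp add: inner_diff_right)
    also have "\<dots> \<le> norm v * norm (x - y)" by (rule norm_cauchy_schwarz)
    also have "\<dots> \<le> 2 * B * norm (x - y)"
      by (intro mult_right_mono \<open>norm v \<le> 2 * B\<close>) auto
    finally show ?thesis .
  qed
  show ?thesis using *[of x y] *[of y x] assms by (simp add: norm_minus_commute abs_le_iff)
qed

section \<open>Sub- and superdifferentials\<close>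

text \<open>First-order form of the test function definition; the differentials of the constructed
  solution are exploited through it.\<close>

lemma superdiffD:
  assumes "g \<in> superdiff U z" "\<epsilon> > 0"
  obtains \<delta> where "\<delta> > 0" "\<And>y. dist y z < \<delta> \<Longrightarrow> U y \<le> U z + g \<bullet> (y - z) + \<epsilon> * norm (y - z)"
proof -
  obtain \<phi> G e where g: "g = G z" and C: "C1_with_grad \<phi> G" and e: "e > 0"
    and mx: "\<And>y. y \<in> ball z e \<Longrightarrow> U y - \<phi> y \<le> U z - \<phi> z"
    using assms(1) unfolding superdiff_def by blast
  have "(\<phi> has_derivative (\<lambda>h. G z \<bullet> h)) (at z)" using C unfolding C1_with_grad_def by blast
  then obtain d where d: "d > 0"
    "\<And>y. norm (y - z) < d \<Longrightarrow> norm (\<phi> y - \<phi> z - G z \<bullet> (y - z)) \<le> \<epsilon> * norm (y - z)"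
    unfolding has_derivative_at_alt using assms(2) by blast
  show ?thesis
  proof (rule that[of "min d e"])
    show "min d e > 0" using d e by simp
    fix y assume y: "dist y z < min d e"
    have "U y - \<phi> y \<le> U z - \<phi> z" using mx[of y] y by (simp add: dist_commute)
    moreover have "\<bar>\<phi> y - \<phi> z - G z \<bullet> (y - z)\<bar> \<le> \<epsilon> * norm (y - z)"
      using d(2)[of y] y by (simp add: dist_norm)
    ultimately show "U y \<le> U z + g \<bullet> (y - z) + \<epsilon> * norm (y - z)" unfolding g by linarith
  qed
qed

lemma C1_with_grad_uminus:
  assumes "C1_with_grad \<phi> G"
  shows "C1_with_grad (\<lambda>z. - \<phi> z) (\<lambda>z. - G z)"
  using assms unfolding C1_with_grad_def
  by (auto intro!: continuous_intros derivative_eq_intros)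

lemma subdiff_iff_superdiff: "g \<in> subdiff U z \<longleftrightarrow> - g \<in> superdiff (\<lambda>z. - U z) z"
proof
  assume "g \<in> subdiff U z"
  then obtain \<phi> G e where g: "g = G z" and C: "C1_with_grad \<phi> G" and e: "e > 0"
    and mx: "\<And>y. y \<in> ball z e \<Longrightarrow> U y - \<phi> y \<ge> U z - \<phi> z"
    unfolding subdiff_def by blast
  then show "- g \<in> superdiff (\<lambda>z. - U z) z"
    unfolding superdiff_def using C1_with_grad_uminus[OF C]
    by (intro CollectI exI[of _ "\<lambda>z. - \<phi> z"] exI[of _ "\<lambda>z. - G z"]) force
next
  assume "- g \<in> superdiff (\<lambda>z. - U z) z"
  then obtain \<phi> G e where g: "- g = G z" and C: "C1_with_grad \<phi> G" and e: "e > 0"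
    and mx: "\<And>y. y \<in> ball z e \<Longrightarrow> - U y - \<phi> y \<le> - U z - \<phi> z"
    unfolding superdiff_def by blast
  have "g = - G z" using g by (metis minus_minus)
  then show "g \<in> subdiff U z"
    unfolding subdiff_def using C1_with_grad_uminus[OF C] e mx
    by (intro CollectI exI[of _ "\<lambda>z. - \<phi> z"] exI[of _ "\<lambda>z. - G z"]) force
qed

lemma subdiffD:
  assumes "g \<in> subdiff U z" "\<epsilon> > 0"
  obtains \<delta> where "\<delta> > 0" "\<And>y. dist y z < \<delta> \<Longrightarrow> U y \<ge> U z + g \<bullet> (y - z) - \<epsilon> * norm (y - z)"
proof -
  from superdiffD[OF assms(1)[unfolded subdiff_iff_superdiff] assms(2)]
  obtain d where "d > 0"
    "\<And>y. dist y z < d \<Longrightarrow> - U y \<le> - U z + - g \<bullet> (y - z) + \<epsilon> * norm (y - z)" by blast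
  then show ?thesis using that[of d] by (force simp: inner_minus_left)
qed

lemma superdiffI:
  assumes "C1_with_grad \<phi> G" "open S" "z \<in> S" "\<And>y. y \<in> S \<Longrightarrow> U y - \<phi> y \<le> U z - \<phi> z"
  shows "G z \<in> superdiff U z"
proof -
  obtain e where "e > 0" "ball z e \<subseteq> S" using assms(2,3) openE by blast
  then show ?thesis using assms(1,4) unfolding superdiff_def by blast
qed

lemma subdiffI:
  assumes "C1_with_grad \<phi> G" "open S" "z \<in> S" "\<And>y. y \<in> S \<Longrightarrow> U y - \<phi> y \<ge> U z - \<phi> z"
  shows "G z \<in> subdiff U z"
proof -
  obtain e where "e > 0" "ball z e \<subseteq> S" using assms(2,3) openE by blast
  then show ?thesis using assms(1,4) unfolding subdiff_def by blast
qed

section \<open>Comparison\<close>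

text \<open>Lets the penalty of the comparison proof grow quadratically beyond a level
  \<open>a\<close> only and still be a C1 test function. At the kink the difference quotient is at
  most \<open>\<bar>h\<bar>\<close>.\<close>

lemma DERIV_pos_part_square:
  "((\<lambda>r::real. (max 0 (r - a))\<^sup>2) has_real_derivative 2 * max 0 (r - a)) (at r)"
proof -
  consider "r < a" | "r > a" | "r = a" by linarith
  then show ?thesis
  proof cases
    case 1
    have "((\<lambda>r::real. 0) has_real_derivative 0) (at r)" by simp
    then have "((\<lambda>r::real. (max 0 (r - a))\<^sup>2) has_real_derivative 0) (at r)"
      by (rule has_field_derivative_transform_within_open[of _ _ _ "{..<a}"]) (use 1 in auto)
    then show ?thesis using 1 by simp
  next
    case 2
    have "((\<lambda>r::real. (r - a)\<^sup>2) has_real_derivative 2 * (r - a)) (at r)"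
      by (auto intro!: derivative_eq_intros)
    then have "((\<lambda>r::real. (max 0 (r - a))\<^sup>2) has_real_derivative 2 * (r - a)) (at r)"
      by (rule has_field_derivative_transform_within_open[of _ _ _ "{a<..}"]) (use 2 in auto)
    then show ?thesis using 2 by simp
  next
    case 3
    have "((\<lambda>h. ((max 0 (a + h - a))\<^sup>2 - (max 0 (a - a))\<^sup>2) / h) \<longlongrightarrow> 0) (at (0::real))"
    proof (rule Lim_null_comparison[where g = "\<lambda>h. \<bar>h\<bar>"])
      show "\<forall>\<^sub>F h in at 0. norm (((max 0 (a + h - a))\<^sup>2 - (max 0 (a - a))\<^sup>2) / h) \<le> \<bar>h\<bar>"
        by (intro always_eventually) (auto simp: max_def power2_eq_square)
      show "((\<lambda>h::real. \<bar>h\<bar>) \<longlongrightarrow> 0) (at 0)" by (intro tendsto_eq_intros) auto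
    qed
    then show ?thesis unfolding 3 DERIV_def by simp
  qed
qed

text \<open>Since \<open>U\<close> and \<open>V\<close> may grow arbitrarily, variables are doubled only inside the domain of
  dependence \<open>d \<le> a + 1\<close>: along \<open>d\<close> the time derivative beats the speed bound \<open>M (1 + norm x)\<close> times the
  space gradient, so that the increasing penalty \<open>\<beta> (d z)\<close> has the right sign.\<close>
lemma comparison_principle:
  fixes H :: "'a::euclidean_space \<Rightarrow> 'a \<Rightarrow> real" and U V :: "real \<times> 'a \<Rightarrow> real"
  assumes M: "M \<ge> 0"
    and Hp: "\<And>x p q. \<bar>H x p - H x q\<bar> \<le> M * (1 + norm x) * norm (p - q)"
    and Hx: "\<And>x y p. \<bar>H x p - H y p\<bar> \<le> M * (1 + norm p) * norm (x - y)"
    and contU: "continuous_on ({0..T} \<times> UNIV) U"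
    and contV: "continuous_on ({0..T} \<times> UNIV) V"
    and sub: "\<And>z g. z \<in> {0<..<T} \<times> UNIV \<Longrightarrow> g \<in> superdiff U z \<Longrightarrow> fst g + H (snd z) (snd g) \<le> 0"
    and super: "\<And>z g. z \<in> {0<..<T} \<times> UNIV \<Longrightarrow> g \<in> subdiff V z \<Longrightarrow> fst g + H (snd z) (snd g) \<ge> 0"
    and init: "\<And>x. U (0, x) \<le> V (0, x)"
    and t0: "0 \<le> t0" "t0 < T"
  shows "U (t0, x0) \<le> V (t0, x0)"
proof (rule ccontr)
  define \<theta> where "\<theta> = U (t0, x0) - V (t0, x0)"
  assume "\<not> U (t0, x0) \<le> V (t0, x0)"
  then have \<theta>: "\<theta> > 0" unfolding \<theta>_def by simp
  \<comment> \<open>The factor 3 comes from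
    \<open>2 * r + 2 * r\<^sup>2 \<le> 3 * (1 + r\<^sup>2)\<close>, which weighs the speed bound
    times the space gradient of \<open>d\<close> against its time derivative.\<close>
  define L where "L = 3 * M"
  \<comment> \<open>\<open>T1\<close> keeps the doubled points away from the final time
    \<open>T\<close>. The choice of \<open>\<kappa>\<close> pushes \<open>d\<close> above
    \<open>a + 1\<close> everywhere at time \<open>T1\<close>, so the domain of dependence closes
    before.\<close>
  define T1 where "T1 = (t0 + T) / 2"
  have T1: "t0 < T1" "T1 < T" "0 < T1" unfolding T1_def using t0 by auto
  define \<kappa> where "\<kappa> = (2 + exp (L * t0) * (1 + x0 \<bullet> x0)) / (T1 - t0)"
  have \<kappa>: "\<kappa> > 0" unfolding \<kappa>_def using T1 by (intro divide_pos_pos add_pos_nonneg) auto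
  define d where "d = (\<lambda>z::real \<times> 'a. exp (L * fst z) * (1 + snd z \<bullet> snd z) + \<kappa> * fst z)"
  define Dd where "Dd = (\<lambda>z::real \<times> 'a. (L * exp (L * fst z) * (1 + snd z \<bullet> snd z) + \<kappa>,
                            (2 * exp (L * fst z)) *\<^sub>R snd z))"
  have d_deriv: "(d has_derivative (\<lambda>h. Dd z \<bullet> h)) (at z)" for z
    unfolding d_def Dd_def
    by (auto intro!: derivative_eq_intros simp: fun_eq_iff inner_prod_def algebra_simps inner_commute)
  have d_cont: "continuous_on S d" for S
    unfolding d_def by (intro continuous_intros)
  have Dd_cont: "continuous_on S Dd" for S
    unfolding Dd_def by (intro continuous_intros)
  define a where "a = d (t0, x0)"
  have a1: "a > 0" unfolding a_def d_def using t0 \<kappa>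
    by (auto intro!: add_pos_nonneg mult_pos_pos)
  have dT1: "d (T1, y) > a + 1" for y
  proof -
    have "\<kappa> * (T1 - t0) = 2 + exp (L * t0) * (1 + x0 \<bullet> x0)" unfolding \<kappa>_def using T1 by simp
    then have "\<kappa> * T1 = a + 2" unfolding a_def d_def by (simp add: algebra_simps)
    moreover have "exp (L * T1) * (1 + y \<bullet> y) \<ge> 0" by simp
    ultimately show ?thesis unfolding d_def fst_conv snd_conv by linarith
  qed
  define \<Omega> where "\<Omega> = {z. 0 \<le> fst z \<and> fst z \<le> T1 \<and> d z \<le> a + 1}"
  have \<Omega>_sub: "\<Omega> \<subseteq> {0..T} \<times> UNIV" unfolding \<Omega>_def using T1 by auto
  have L0: "L \<ge> 0" unfolding L_def using M by simp
  have "compact \<Omega>"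
  proof -
    have "closed \<Omega>" unfolding \<Omega>_def
      by (intro closed_Collect_conj closed_Collect_le continuous_intros d_cont)
    moreover have "\<Omega> \<subseteq> {0..T1} \<times> cball 0 (a + 1)"
    proof
      fix z assume z: "z \<in> \<Omega>"
      have "1 * (1 + snd z \<bullet> snd z) \<le> exp (L * fst z) * (1 + snd z \<bullet> snd z)"
        using z L0 unfolding \<Omega>_def by (intro mult_right_mono) auto
      then have "1 + snd z \<bullet> snd z \<le> a + 1"
        using z \<kappa> unfolding \<Omega>_def d_def by (smt (verit) mem_Collect_eq mult_nonneg_nonneg)
      then have "(norm (snd z))\<^sup>2 \<le> a" by (simp add: power2_norm_eq_inner)
      moreover have "2 * norm (snd z) \<le> 1 + (norm (snd z))\<^sup>2"
        using zero_le_power2[of "norm (snd z) - 1"] by (simp add: power2_diff)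
      ultimately have "norm (snd z) \<le> a + 1" using a1 by linarith
      then show "z \<in> {0..T1} \<times> cball 0 (a + 1)" using z unfolding \<Omega>_def by (cases z) auto
    qed
    moreover have "compact ({0..T1} \<times> cball (0::'a) (a + 1))" by (intro compact_Times) auto
    ultimately show ?thesis by (metis closed_Int_compact inf.absorb1)
  qed
  have cU: "continuous_on \<Omega> U" and cV: "continuous_on \<Omega> V"
    using contU contV \<Omega>_sub continuous_on_subset by blast+
  have z0: "(t0, x0) \<in> \<Omega>" unfolding \<Omega>_def a_def using t0 T1 by auto
  obtain C1 where C1: "\<And>z. z \<in> \<Omega> \<Longrightarrow> \<bar>U z\<bar> \<le> C1"
    using compact_imp_bounded[OF compact_continuous_image[OF cU \<open>compact \<Omega>\<close>]]
    unfolding bounded_iff by auto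
  obtain C2 where C2: "\<And>z. z \<in> \<Omega> \<Longrightarrow> \<bar>V z\<bar> \<le> C2"
    using compact_imp_bounded[OF compact_continuous_image[OF cV \<open>compact \<Omega>\<close>]]
    unfolding bounded_iff by auto
  \<comment> \<open>At \<open>d = a + 1\<close> the penalty is at least \<open>K\<close>, more than
    \<open>U - V\<close> can reach on \<open>\<Omega>\<close>. At \<open>(t0, x0)\<close> the linear
    part costs only \<open>\<theta> / 2\<close>, so half of the gap survives; its slope
    \<open>\<eta>\<close> makes the final inequality strict.\<close>
  define K where "K = C1 + C2 + 1"
  have K: "K > 0" using C1[OF z0] C2[OF z0] unfolding K_def by linarith
  define \<eta> where "\<eta> = \<theta> / (2 * a)"
  have \<eta>: "\<eta> > 0" unfolding \<eta>_def using \<theta> a1 by simp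
  define \<beta> where "\<beta> = (\<lambda>r. \<eta> * r + K * (max 0 (r - a))\<^sup>2)"
  define \<beta>' where "\<beta>' = (\<lambda>r. \<eta> + 2 * K * max 0 (r - a))"
  have \<beta>_deriv: "(\<beta> has_real_derivative \<beta>' r) (at r)" for r
    using DERIV_add[OF DERIV_cmult_Id[of \<eta>] DERIV_cmult[OF DERIV_pos_part_square[of a r], of K]]
    unfolding \<beta>_def \<beta>'_def by (simp add: mult.assoc mult.left_commute)
  have \<beta>'_ge: "\<beta>' r \<ge> \<eta>" for r unfolding \<beta>'_def using K by simp
  have \<beta>_cont: "continuous_on S (\<lambda>z. \<beta> (d z))" for S
    unfolding \<beta>_def by (intro continuous_intros d_cont)
  have \<beta>d_deriv: "((\<lambda>z. \<beta> (d z)) has_derivative (\<lambda>h. (\<beta>' (d z) *\<^sub>R Dd z) \<bullet> h)) (at z)" for z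
    using has_derivative_compose[OF d_deriv \<beta>_deriv[unfolded has_field_derivative_def]]
    by simp
  have \<beta>a: "\<beta> (d (t0, x0)) = \<theta> / 2" unfolding \<beta>_def a_def[symmetric] \<eta>_def using a1 by simp

  define N where "N = (\<lambda>n::nat. real n + 1)"
  have N: "N n > 0" for n unfolding N_def by simp
  \<comment> \<open>Doubling in time and space together, with the penalty \<open>\<beta>\<close>
    charged to the first point only.\<close>
  define \<Phi> where "\<Phi> = (\<lambda>n (zw :: (real \<times> 'a) \<times> (real \<times> 'a)). U (fst zw) - V (snd zw) - \<beta> (d (fst zw))
                    - N n / 2 * ((fst zw - snd zw) \<bullet> (fst zw - snd zw)))"
  have "\<exists>zw\<in>\<Omega> \<times> \<Omega>. \<forall>y\<in>\<Omega> \<times> \<Omega>. \<Phi> n y \<le> \<Phi> n zw" for n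
  proof (rule continuous_attains_sup)
    show "compact (\<Omega> \<times> \<Omega>)" by (intro compact_Times \<open>compact \<Omega>\<close>)
    show "\<Omega> \<times> \<Omega> \<noteq> {}" using z0 by auto
    show "continuous_on (\<Omega> \<times> \<Omega>) (\<Phi> n)" unfolding \<Phi>_def
      by (intro continuous_intros continuous_on_compose2[OF cU] continuous_on_compose2[OF cV]
          continuous_on_compose2[OF \<beta>_cont[of UNIV]]) auto
  qed
  then obtain zw where zw: "\<And>n. zw n \<in> \<Omega> \<times> \<Omega>" "\<And>n y. y \<in> \<Omega> \<times> \<Omega> \<Longrightarrow> \<Phi> n y \<le> \<Phi> n (zw n)"
    by metis
  have "compact (\<Omega> \<times> \<Omega>)" by (intro compact_Times \<open>compact \<Omega>\<close>)
  then obtain l \<rho> where l: "l \<in> \<Omega> \<times> \<Omega>" and \<rho>: "strict_mono (\<rho>::nat\<Rightarrow>nat)" and lim: "(zw \<circ> \<rho>) \<longlonglongrightarrow> l"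
    using zw(1) unfolding compact_def by metis
  define z where "z = (\<lambda>n. fst (zw (\<rho> n)))"
  define w where "w = (\<lambda>n. snd (zw (\<rho> n)))"
  define N' where "N' = (\<lambda>n. N (\<rho> n))"
  have zw_in: "z n \<in> \<Omega>" "w n \<in> \<Omega>" for n using zw(1)[of "\<rho> n"] unfolding z_def w_def by auto
  have N'pos: "N' n > 0" for n unfolding N'_def using N by simp
  have zlim: "z \<longlonglongrightarrow> fst l" and wlim: "w \<longlonglongrightarrow> snd l"
    using tendsto_fst[OF lim] tendsto_snd[OF lim] unfolding z_def w_def comp_def by auto
  have mx: "U y - V y' - \<beta> (d y) - N' n / 2 * ((y - y') \<bullet> (y - y'))
      \<le> U (z n) - V (w n) - \<beta> (d (z n)) - N' n / 2 * ((z n - w n) \<bullet> (z n - w n))"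
    if "y \<in> \<Omega>" "y' \<in> \<Omega>" for y y' n
    using zw(2)[of "(y, y')" "\<rho> n"] that unfolding \<Phi>_def z_def w_def N'_def by simp
  have N'_inf: "filterlim N' at_top sequentially"
  proof -
    have "filterlim (\<lambda>n. real (\<rho> n)) at_top sequentially"
      using filterlim_compose[OF filterlim_real_sequentially filterlim_subseq[OF \<rho>]] .
    then show ?thesis unfolding N'_def N_def
      by (rule filterlim_at_top_mono) (auto intro!: always_eventually)
  qed
  have dist0: "fst l = snd l"
  proof -
    have bd: "(z n - w n) \<bullet> (z n - w n) \<le> (2 * C1 + 2 * C2 + \<beta> (d (t0,x0))) * 2 / N' n" for n
    proof -
      have "\<beta> (d (z n)) \<ge> 0"
      proof -
        have "d (z n) \<ge> 0" using zw_in(1)[of n] \<kappa> unfolding d_def \<Omega>_def by auto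
        then show ?thesis unfolding \<beta>_def using \<eta> K by simp
      qed
      then have "N' n / 2 * ((z n - w n) \<bullet> (z n - w n)) \<le> 2 * C1 + 2 * C2 + \<beta> (d (t0,x0))"
        using mx[OF z0 z0, of n] C1[OF z0] C2[OF z0] C1[OF zw_in(1)[of n]] C2[OF zw_in(2)[of n]]
        by simp
      then show ?thesis using N'pos[of n] by (simp add: field_simps)
    qed
    have "(\<lambda>n. (z n - w n) \<bullet> (z n - w n)) \<longlonglongrightarrow> 0"
    proof (rule tendsto_sandwich[OF _ _ tendsto_const])
      show "\<forall>\<^sub>F n in sequentially. (z n - w n) \<bullet> (z n - w n) \<le> (2 * C1 + 2 * C2 + \<beta> (d (t0,x0))) * 2 / N' n"
        using bd by (intro always_eventually) auto
      show "(\<lambda>n. (2 * C1 + 2 * C2 + \<beta> (d (t0,x0))) * 2 / N' n) \<longlonglongrightarrow> 0"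
        by (intro real_tendsto_divide_at_top[OF tendsto_const N'_inf])
    qed auto
    moreover have "(\<lambda>n. (z n - w n) \<bullet> (z n - w n)) \<longlonglongrightarrow> (fst l - snd l) \<bullet> (fst l - snd l)"
      by (intro tendsto_intros zlim wlim)
    ultimately have "(fst l - snd l) \<bullet> (fst l - snd l) = 0" using LIMSEQ_unique by blast
    then show ?thesis by simp
  qed
  define b where "b = fst l"
  have b_in: "b \<in> \<Omega>" using l unfolding b_def by auto
  have zb: "z \<longlonglongrightarrow> b" and wb: "w \<longlonglongrightarrow> b" using zlim wlim dist0 b_def by auto
  have Ub: "(\<lambda>n. U (z n)) \<longlonglongrightarrow> U b" and Vb: "(\<lambda>n. V (w n)) \<longlonglongrightarrow> V b"
    using cU cV zb wb zw_in b_in unfolding continuous_on_sequentially comp_def by auto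
  have \<beta>b: "(\<lambda>n. \<beta> (d (z n))) \<longlonglongrightarrow> \<beta> (d b)"
    using \<beta>_cont[of UNIV] zb by (rule continuous_on_tendsto_compose) auto
  \<comment> \<open>The maximum is at least the value at the diagonal point \<open>(b, b)\<close>;
    so the quadratic term is bounded by a difference of unpenalised values that tends to 0.\<close>
  have pen0: "(\<lambda>n. N' n * ((z n - w n) \<bullet> (z n - w n))) \<longlonglongrightarrow> 0"
  proof (rule tendsto_sandwich[OF _ _ tendsto_const])
    show "\<forall>\<^sub>F n in sequentially. N' n * ((z n - w n) \<bullet> (z n - w n))
       \<le> 2 * (U (z n) - V (w n) - \<beta> (d (z n)) - (U b - V b - \<beta> (d b)))"
      using mx[OF b_in b_in] by (intro always_eventually) (simp add: field_simps)
    have "(\<lambda>n. 2 * (U (z n) - V (w n) - \<beta> (d (z n)) - (U b - V b - \<beta> (d b)))) \<longlonglongrightarrow> 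
      2 * (U b - V b - \<beta> (d b) - (U b - V b - \<beta> (d b)))"
      by (intro tendsto_intros Ub Vb \<beta>b)
    then show "(\<lambda>n. 2 * (U (z n) - V (w n) - \<beta> (d (z n)) - (U b - V b - \<beta> (d b)))) \<longlonglongrightarrow> 0" by simp
    show "\<forall>\<^sub>F n in sequentially. 0 \<le> N' n * ((z n - w n) \<bullet> (z n - w n))"
      using N'pos by (intro always_eventually) (auto simp: less_imp_le)
  qed
  have posb: "U b - V b - \<beta> (d b) \<ge> \<theta> / 2"
  proof (rule tendsto_lowerbound[OF tendsto_diff[OF tendsto_diff[OF Ub Vb] \<beta>b]])
    show "\<forall>\<^sub>F n in sequentially. \<theta> / 2 \<le> U (z n) - V (w n) - \<beta> (d (z n))"
    proof (intro always_eventually allI)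
      fix n
      have "N' n / 2 * ((z n - w n) \<bullet> (z n - w n)) \<ge> 0" using N'pos[of n] by simp
      then show "\<theta> / 2 \<le> U (z n) - V (w n) - \<beta> (d (z n))"
        using mx[OF z0 z0, of n] unfolding \<beta>a \<theta>_def by (simp add: field_simps)
    qed
  qed simp
  have d0: "d y \<ge> 0" if "y \<in> \<Omega>" for y using that \<kappa> unfolding d_def \<Omega>_def by auto
  \<comment> \<open>The limit point avoids the boundary of \<open>\<Omega>\<close>: the bottom by
    the initial inequality, the level \<open>a + 1\<close> by the choice of \<open>K\<close>, and
    time \<open>T1\<close> because \<open>d\<close> is too large there. Hence late pairs lie in the
    open set \<open>Q\<close>, where both inequalities are available.\<close>
  have b_pos: "fst b > 0"
  proof (rule ccontr)
    assume "\<not> fst b > 0"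
    then have "fst b = 0" using b_in unfolding \<Omega>_def by auto
    then have "U b \<le> V b" using init[of "snd b"] by (cases b) auto
    moreover have "\<beta> (d b) \<ge> 0" using d0[OF b_in] \<eta> K unfolding \<beta>_def by simp
    ultimately show False using posb \<theta> by linarith
  qed
  have b_d: "d b < a + 1"
  proof (rule ccontr)
    assume "\<not> d b < a + 1"
    then have "d b = a + 1" using b_in unfolding \<Omega>_def by auto
    then have "\<beta> (d b) \<ge> K" unfolding \<beta>_def using \<eta> a1 by simp
    then show False using posb \<theta> C1[OF b_in] C2[OF b_in] unfolding K_def by linarith
  qed
  have b_T1: "fst b < T1"
  proof (rule ccontr)
    assume "\<not> fst b < T1"
    then have "fst b = T1" using b_in unfolding \<Omega>_def by auto
    then show False using dT1[of "snd b"] b_d by (cases b) auto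
  qed
  define Q where "Q = {z. 0 < fst z \<and> fst z < T1 \<and> d z < a + 1}"
  have "open Q" unfolding Q_def
    by (intro open_Collect_conj open_Collect_less continuous_intros d_cont)
  have Q\<Omega>: "Q \<subseteq> \<Omega>" unfolding Q_def \<Omega>_def by auto
  have Q_T: "Q \<subseteq> {0<..<T} \<times> UNIV" unfolding Q_def using T1 by auto
  have "b \<in> Q" unfolding Q_def using b_pos b_d b_T1 by simp
  then have ev: "\<forall>\<^sub>F n in sequentially. z n \<in> Q \<and> w n \<in> Q"
    using topological_tendstoD[OF zb \<open>open Q\<close>] topological_tendstoD[OF wb \<open>open Q\<close>]
    by (simp add: eventually_conj)
  \<comment> \<open>The difference of the two viscosity inequalities: the quadratic term contributes
    the same time derivative and the same momentum \<open>P\<close> to both, so only the change of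
    base point in \<open>H\<close> and the gradient of \<open>\<beta> (d z)\<close> remain. The
    right side tends to 0.\<close>
  have "\<forall>\<^sub>F n in sequentially. \<eta> * \<kappa> \<le> M * norm (z n - w n) + M * (N' n * ((z n - w n) \<bullet> (z n - w n)))"
    using ev
  proof eventually_elim
    case (elim n)
    have sq: "((\<lambda>y. N' n / 2 * ((y - y') \<bullet> (y - y'))) has_derivative (\<lambda>h. (N' n *\<^sub>R (y - y')) \<bullet> h)) (at y)"
      for y y' :: "real \<times> 'a"
      by (auto intro!: derivative_eq_intros simp: fun_eq_iff inner_commute algebra_simps)
    have "C1_with_grad (\<lambda>y. V (w n) + \<beta> (d y) + N' n / 2 * ((y - w n) \<bullet> (y - w n)))
         (\<lambda>y. \<beta>' (d y) *\<^sub>R Dd y + N' n *\<^sub>R (y - w n))"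
      unfolding C1_with_grad_def
    proof (intro conjI allI)
      show "continuous_on UNIV (\<lambda>y. \<beta>' (d y) *\<^sub>R Dd y + N' n *\<^sub>R (y - w n))"
        unfolding \<beta>'_def by (intro continuous_intros d_cont Dd_cont)
      show "((\<lambda>y. V (w n) + \<beta> (d y) + N' n / 2 * ((y - w n) \<bullet> (y - w n)))
         has_derivative (\<lambda>h. (\<beta>' (d y) *\<^sub>R Dd y + N' n *\<^sub>R (y - w n)) \<bullet> h)) (at y)" for y
        using has_derivative_add[OF has_derivative_add[OF has_derivative_const \<beta>d_deriv] sq]
        by (simp add: inner_add_left)
    qed
    then have "\<beta>' (d (z n)) *\<^sub>R Dd (z n) + N' n *\<^sub>R (z n - w n) \<in> superdiff U (z n)"
    proof (rule superdiffI[OF _ \<open>open Q\<close>])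
      show "z n \<in> Q" using elim by simp
      fix y assume "y \<in> Q"
      then show "U y - (V (w n) + \<beta> (d y) + N' n / 2 * ((y - w n) \<bullet> (y - w n)))
        \<le> U (z n) - (V (w n) + \<beta> (d (z n)) + N' n / 2 * ((z n - w n) \<bullet> (z n - w n)))"
        using mx[of y "w n" n] zw_in Q\<Omega> by auto
    qed
    from sub[OF _ this] elim Q_T
    have s1: "\<beta>' (d (z n)) * fst (Dd (z n)) + N' n * (fst (z n) - fst (w n)) 
       + H (snd (z n)) (\<beta>' (d (z n)) *\<^sub>R snd (Dd (z n)) + N' n *\<^sub>R (snd (z n) - snd (w n))) \<le> 0"
      by auto
    have "C1_with_grad (\<lambda>y. U (z n) - (N' n / 2 * ((y - z n) \<bullet> (y - z n))))
         (\<lambda>y. - (N' n *\<^sub>R (y - z n)))"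
      unfolding C1_with_grad_def
    proof (intro conjI allI)
      show "continuous_on UNIV (\<lambda>y. - (N' n *\<^sub>R (y - z n)))" by (intro continuous_intros)
      show "((\<lambda>y. U (z n) - (N' n / 2 * ((y - z n) \<bullet> (y - z n))))
         has_derivative (\<lambda>h. (- (N' n *\<^sub>R (y - z n))) \<bullet> h)) (at y)" for y
        using has_derivative_diff[OF has_derivative_const sq] by (simp add: inner_minus_left)
    qed
    then have "- (N' n *\<^sub>R (w n - z n)) \<in> subdiff V (w n)"
    proof (rule subdiffI[OF _ \<open>open Q\<close>])
      show "w n \<in> Q" using elim by simp
      fix y assume "y \<in> Q"
      moreover have "(z n - y) \<bullet> (z n - y) = (y - z n) \<bullet> (y - z n)" for y
        by (metis dot_square_norm norm_minus_commute)
      ultimately show "V y - (U (z n) - (N' n / 2 * ((y - z n) \<bullet> (y - z n))))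
        \<ge> V (w n) - (U (z n) - (N' n / 2 * ((w n - z n) \<bullet> (w n - z n))))"
        using mx[of "z n" y n] zw_in Q\<Omega> by auto
    qed
    from super[OF _ this] elim Q_T
    have s2: "N' n * (fst (z n) - fst (w n)) + H (snd (w n)) (N' n *\<^sub>R (snd (z n) - snd (w n))) \<ge> 0"
      by (auto simp: algebra_simps scaleR_diff_right)
    define t x y where "t = fst (z n)" and "x = snd (z n)" and "y = snd (w n)"
    define P where "P = N' n *\<^sub>R (x - y)"
    define B where "B = \<beta>' (d (z n))"
    have B: "B \<ge> \<eta>" "B \<ge> 0" unfolding B_def using \<beta>'_ge[of "d (z n)"] \<eta> by auto
    have main: "B * (fst (Dd (z n)) - M * (1 + norm x) * norm (snd (Dd (z n)))) \<le> M * (1 + norm P) * norm (x - y)"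
    proof -
      have "B * fst (Dd (z n)) + H x (B *\<^sub>R snd (Dd (z n)) + P) - H y P \<le> 0"
        using s1 s2 unfolding B_def P_def x_def y_def by linarith
      moreover have "H x P - H x (B *\<^sub>R snd (Dd (z n)) + P) \<le> M * (1 + norm x) * (B * norm (snd (Dd (z n))))"
        using Hp[of x P "B *\<^sub>R snd (Dd (z n)) + P"] B by simp
      moreover have "H y P - H x P \<le> M * (1 + norm P) * norm (x - y)"
        using Hx[of y P x] by (simp add: norm_minus_commute)
      ultimately show ?thesis by (simp add: algebra_simps)
    qed
    \<comment> \<open>The exponential part of \<open>d\<close> absorbs the speed bound; its linear
      part in time is left over.\<close>
    have "fst (Dd (z n)) - M * (1 + norm x) * norm (snd (Dd (z n))) \<ge> \<kappa>"
    proof -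
      define e where "e = exp (L * t)"
      have e: "e > 0" unfolding e_def by simp
      have "M * (1 + norm x) * (2 * e * norm x) = (M * e) * (2 * norm x + 2 * (norm x)\<^sup>2)"
        by (simp add: algebra_simps power2_eq_square)
      also have "\<dots> \<le> (M * e) * (3 * (1 + (norm x)\<^sup>2))"
      proof (rule mult_left_mono)
        show "2 * norm x + 2 * (norm x)\<^sup>2 \<le> 3 * (1 + (norm x)\<^sup>2)"
          using zero_le_power2[of "norm x - 1"] unfolding power2_diff by simp
      qed (use M e in simp)
      finally show ?thesis unfolding Dd_def L_def[symmetric] x_def[symmetric] t_def[symmetric] fst_conv snd_conv e_def[symmetric]
        using e by (simp add: L_def power2_norm_eq_inner algebra_simps)
    qed
    then have "\<eta> * \<kappa> \<le> B * (fst (Dd (z n)) - M * (1 + norm x) * norm (snd (Dd (z n))))"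
      using B \<eta> \<kappa> by (intro mult_mono) auto
    also note main
    also have "M * (1 + norm P) * norm (x - y) = M * norm (x - y) + M * (N' n * (norm (x - y))\<^sup>2)"
    proof -
      have "norm P = N' n * norm (x - y)" unfolding P_def using N'pos[of n] by simp
      then show ?thesis by (simp add: algebra_simps power2_eq_square)
    qed
    also have "\<dots> \<le> M * norm (z n - w n) + M * (N' n * (norm (z n - w n))\<^sup>2)"
    proof -
      have "norm (x - y) \<le> norm (z n - w n)"
        unfolding x_def y_def snd_diff[symmetric]
        by (rule order_trans[OF norm_snd_le[of _ "fst (z n - w n)"]]) (simp only: prod.collapse)
      then show ?thesis using M N'pos[of n]
        by (intro add_mono mult_left_mono power_mono) auto
    qed
    finally show ?case by (simp add: power2_norm_eq_inner)
  qed
  note ev_le = this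
  have "(\<lambda>n. M * norm (z n - w n) + M * (N' n * ((z n - w n) \<bullet> (z n - w n)))) \<longlonglongrightarrow> M * norm (b - b) + M * 0"
    by (intro tendsto_intros zb wb pen0)
  from tendsto_lowerbound[OF this ev_le] have "\<eta> * \<kappa> \<le> M * norm (b - b) + M * 0" by simp
  then show False using mult_pos_pos[OF \<eta> \<kappa>] by simp
qed

section \<open>Subsolutions on the subdifferential\<close>

text \<open>Barron--Jensen: if \<open>(q, p)\<close> violated the inequality, then along the line \<open>x + s v\<close>, where \<open>v\<close> is a
  subgradient of \<open>H x\<close> at \<open>p\<close>, \<open>U\<close> would overtake the smoothed cone \<open>\<psi>\<close>, which is a strict
  supersolution whose slope exceeds that of \<open>U\<close> at time \<open>t\<close>. The term \<open>B \<sigma>\<^sup>2\<close> keeps the maximum off the final time.\<close>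
lemma subdiff_of_subsolution:
  fixes H :: "'a::euclidean_space \<Rightarrow> 'a \<Rightarrow> real" and U :: "real \<times> 'a \<Rightarrow> real"
  assumes M: "M \<ge> 0"
    and convH: "convex_on UNIV (H x)"
    and Hx: "\<And>x y p. \<bar>H x p - H y p\<bar> \<le> M * (1 + norm p) * norm (x - y)"
    and contU: "continuous_on ({0<..} \<times> UNIV) U"
    and sub: "\<And>z g. z \<in> {0<..} \<times> UNIV \<Longrightarrow> g \<in> superdiff U z \<Longrightarrow> fst g + H (snd z) (snd g) \<le> 0"
    and t: "t > 0" and r0: "r0 > 0" and R: "R \<ge> 0"
    and lip: "\<And>y. norm (y - x) \<le> r0 \<Longrightarrow> U (t, y) \<le> U (t, x) + R * norm (y - x)"
    and g: "g \<in> subdiff U (t, x)"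
  shows "fst g + H x (snd g) \<le> 0"
proof (rule ccontr)
  obtain q p where gqp: "g = (q, p)" by (cases g)
  \<comment> \<open>A third of the excess: \<open>k\<close> uses up one share, which leaves a gain
    of \<open>2 * (\<epsilon> * s)\<close> at time \<open>s\<close>. The first-order error,
    \<open>\<delta>\<close> and \<open>B * s\<^sup>2\<close> each consume at most
    \<open>\<epsilon> * s / 2\<close> of it.\<close>
  define \<epsilon> where "\<epsilon> = (q + H x p) / 3"
  assume "\<not> fst g + H x (snd g) \<le> 0"
  then have \<epsilon>: "\<epsilon> > 0" unfolding \<epsilon>_def gqp by simp
  obtain v where v: "\<And>p'. H x p + v \<bullet> (p' - p) \<le> H x p'"
    using convex_subgradient_exists[OF convH] by blast
  define R' where "R' = R + 1"
  \<comment> \<open>With this rate, \<open>k - v \<bullet> p' + H x p' \<ge> \<epsilon>\<close> for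
    every momentum \<open>p'\<close>, by the subgradient inequality; this is the strict
    supersolution property with the base point frozen at \<open>x\<close>.\<close>
  define k where "k = p \<bullet> v - H x p + \<epsilon>"
  define K where "K = M * (1 + R') * 2 + 1"
  \<comment> \<open>The points considered lie within \<open>2 * r\<close> of \<open>x\<close>; for
    momenta of norm at most \<open>R'\<close>, moving the base point of \<open>H\<close> to
    \<open>x\<close> then costs less than \<open>\<epsilon>\<close>.\<close>
  define r where "r = min r0 (\<epsilon> / (2 * K))"
  have R': "R' > 0" unfolding R'_def using R by simp
  have den: "K > 0" unfolding K_def using M R' by (intro add_nonneg_pos) auto
  have r: "r > 0" "r \<le> r0" unfolding r_def using r0 \<epsilon> den by auto
  have rM: "M * (1 + R') * (2 * r) < \<epsilon>"
  proof -
    have "K * r \<le> K * (\<epsilon> / (2 * K))"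
      using den unfolding r_def by (intro mult_left_mono) auto
    also have "\<dots> = \<epsilon> / 2" using den by simp
    finally show ?thesis using r \<epsilon> by (simp add: K_def algebra_simps)
  qed
  define W where "W = (\<lambda>sz. U (t + fst sz, x + snd sz + fst sz *\<^sub>R v))"
  have W_cont: "continuous_on ({0..1} \<times> cball 0 r) W"
    unfolding W_def
    by (rule continuous_on_compose2[OF contU]) (use t in \<open>auto intro!: continuous_intros\<close>)
  have "compact ({0..1::real} \<times> cball (0::'a) r)" by (intro compact_Times) auto
  from compact_uniformly_continuous[OF W_cont this]
  obtain d where d: "d > 0" and dW: "\<And>a b. a \<in> {0..1} \<times> cball 0 r \<Longrightarrow> b \<in> {0..1} \<times> cball 0 r \<Longrightarrow> 
      dist b a < d \<Longrightarrow> dist (W b) (W a) < r / 2"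
    unfolding uniformly_continuous_on_def using r by (meson half_gt_zero)
  \<comment> \<open>Up to time \<open>s1\<close>, both \<open>W\<close> and
    \<open>k * \<sigma>\<close> change by less than \<open>r / 2\<close>, and the centre
    \<open>x + \<sigma> *\<^sub>R v\<close> moves by at most \<open>r\<close>.\<close>
  define s1 where "s1 = min (min 1 (d / 2)) (min (r / (4 * (\<bar>k\<bar> + 1))) (r / (norm v + 1)))"
  have s1: "s1 > 0" "s1 \<le> 1" "s1 < d" unfolding s1_def using d r by (auto simp: add_nonneg_pos intro!: divide_pos_pos)
  have s1k: "\<bar>k\<bar> * s1 < r / 2"
  proof -
    have "(\<bar>k\<bar> + 1) * s1 \<le> (\<bar>k\<bar> + 1) * (r / (4 * (\<bar>k\<bar> + 1)))"
      unfolding s1_def by (intro mult_left_mono) auto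
    also have "\<dots> = r / 4" by (simp add: field_simps)
    finally show ?thesis using s1 r by (simp add: algebra_simps)
  qed
  have s1v: "s1 * norm v \<le> r"
  proof -
    have "s1 * (norm v + 1) \<le> (r / (norm v + 1)) * (norm v + 1)"
      unfolding s1_def by (intro mult_right_mono) auto
    also have "\<dots> = r" by (simp add: add_nonneg_eq_0_iff)
    finally show ?thesis using s1 by (simp add: algebra_simps)
  qed
  have Wt: "W (\<sigma>, z) \<le> U (t, x) + R * norm z + r / 2" if "0 \<le> \<sigma>" "\<sigma> \<le> s1" "norm z \<le> r" for \<sigma> z
  proof -
    have "dist (W (\<sigma>, z)) (W (0, z)) < r / 2"
      by (rule dW) (use that s1 in \<open>auto simp: dist_Pair_Pair\<close>)
    moreover have "W (0, z) \<le> U (t, x) + R * norm z" unfolding W_def using lip[of "x + z"] that r by simp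
    ultimately show ?thesis unfolding dist_real_def by linarith
  qed
  \<comment> \<open>Makes \<open>B * \<sigma>\<^sup>2\<close> equal to \<open>R * r + r\<close> at
    \<open>\<sigma> = s1\<close>, which covers the growth \<open>R * r + r / 2\<close> of
    \<open>W\<close> and the possible loss \<open>r / 2\<close> in
    \<open>k * \<sigma>\<close>.\<close>
  define B where "B = (R + 1) * r / s1\<^sup>2"
  have B: "B > 0" unfolding B_def using R r s1 by simp
  have Bs1: "B * s1\<^sup>2 = (R + 1) * r" unfolding B_def using s1 by simp
  define e1 where "e1 = \<epsilon> / (2 * (1 + norm v))"
  have e1: "e1 > 0" unfolding e1_def using \<epsilon> by (intro divide_pos_pos mult_pos_pos add_pos_nonneg) auto
  have nv1: "1 + norm v > 0" by (simp add: add_pos_nonneg)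
  have canc: "b / (2 * c) * c = b / 2" if "c > 0" for b c :: real using that by simp
  obtain d1 where d1: "d1 > 0" "\<And>y. dist y (t, x) < d1 \<Longrightarrow> U y \<ge> U (t, x) + g \<bullet> (y - (t, x)) - e1 * norm (y - (t, x))"
    using subdiffD[OF g e1] by blast
  define s where "s = min (min s1 (\<epsilon> / (2 * B))) (d1 / (2 * (1 + norm v)))"
  have s: "s > 0" "s \<le> s1" "s \<le> \<epsilon> / (2 * B)"
    unfolding s_def using s1 \<epsilon> B d1 by (auto intro!: divide_pos_pos mult_pos_pos add_pos_nonneg)
  define \<delta> where "\<delta> = \<epsilon> * s / 2"
  have \<delta>: "\<delta> > 0" unfolding \<delta>_def using \<epsilon> s by simp
  \<comment> \<open>A smoothing of the cone \<open>R' * norm z\<close> from above, with value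
    \<open>\<delta>\<close> at the tip and gradient of norm at most \<open>R'\<close>.\<close>
  define S where "S = (\<lambda>z::'a. sqrt (R'\<^sup>2 * (z \<bullet> z) + \<delta>\<^sup>2))"
  have arg_pos: "R'\<^sup>2 * (z \<bullet> z) + \<delta>\<^sup>2 > 0" for z :: 'a using \<delta> by (intro add_nonneg_pos) auto
  have S_pos: "S z > 0" for z unfolding S_def using arg_pos by simp
  have S_ge: "S z \<ge> R' * norm z" for z
    unfolding S_def by (rule real_le_rsqrt) (simp add: power_mult_distrib power2_norm_eq_inner)
  have S0: "S 0 = \<delta>" unfolding S_def using \<delta> by simp
  define \<psi> where "\<psi> = (\<lambda>\<sigma> z. U (t, x) + k * \<sigma> + S z + B * \<sigma>\<^sup>2)"
  define Q where "Q = {0..s1} \<times> cball (0::'a) r"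
  have "compact Q" unfolding Q_def by (intro compact_Times) auto
  have "Q \<noteq> {}" unfolding Q_def using s1 r by auto
  have cQ: "continuous_on Q (\<lambda>sz. W sz - \<psi> (fst sz) (snd sz))"
  proof -
    have "continuous_on Q W" by (rule continuous_on_subset[OF W_cont]) (use s1 in \<open>auto simp: Q_def\<close>)
    then show ?thesis unfolding \<psi>_def S_def by (intro continuous_intros)
  qed
  from continuous_attains_sup[OF \<open>compact Q\<close> \<open>Q \<noteq> {}\<close> cQ] obtain m where m: "m \<in> Q" "\<And>y. y \<in> Q \<Longrightarrow> W y - \<psi> (fst y) (snd y) \<le> W m - \<psi> (fst m) (snd m)"
    by blast
  \<comment> \<open>The subdifferential forces \<open>W\<close> above \<open>\<psi>\<close> at
    \<open>(s, 0)\<close>, on the line through \<open>x\<close> with velocity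
    \<open>v\<close>.\<close>
  have pos: "W m - \<psi> (fst m) (snd m) > 0"
  proof -
    have nv: "norm ((s, s *\<^sub>R v)) \<le> s * (1 + norm v)"
      using norm_Pair_le[of s "s *\<^sub>R v"] s by (simp add: algebra_simps)
    have "s * (1 + norm v) \<le> (d1 / (2 * (1 + norm v))) * (1 + norm v)"
      unfolding s_def by (intro mult_right_mono) auto
    also have "\<dots> = d1 / 2" by (rule canc[OF nv1])
    finally have "s * (1 + norm v) < d1" using d1 by simp
    then have "dist (t + s, x + s *\<^sub>R v) (t, x) < d1" using nv by (simp add: dist_norm)
    from d1(2)[OF this] have "W (s, 0) \<ge> U (t, x) + s * (q + p \<bullet> v) - e1 * norm (s, s *\<^sub>R v)"
      unfolding W_def gqp by (simp add: algebra_simps)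
    moreover have "e1 * norm (s, s *\<^sub>R v) \<le> e1 * (s * (1 + norm v))"
      using nv e1 by (intro mult_left_mono) auto
    moreover have "e1 * (s * (1 + norm v)) = \<epsilon> * s / 2"
      using canc[OF nv1, of "\<epsilon> * s"] unfolding e1_def by (simp add: mult.commute mult.left_commute)
    ultimately have 1: "W (s, 0) \<ge> U (t, x) + s * (q + p \<bullet> v) - \<epsilon> * s / 2" by linarith
    have "B * s\<^sup>2 \<le> \<epsilon> * s / 2"
    proof -
      have "B * s \<le> \<epsilon> / 2" using s(3) B by (simp add: field_simps)
      then have "B * s * s \<le> \<epsilon> / 2 * s" using s by (intro mult_right_mono) auto
      then show ?thesis by (simp add: power2_eq_square)
    qed
    moreover have "s * (q + p \<bullet> v) - k * s = 2 * (\<epsilon> * s)" unfolding k_def \<epsilon>_def by (simp add: field_simps)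
    ultimately have "W (s, 0) - \<psi> s 0 \<ge> 2 * (\<epsilon> * s) - \<epsilon> * s / 2 - \<epsilon> * s / 2 - \<epsilon> * s / 2"
      using 1 unfolding \<psi>_def S0 \<delta>_def by linarith
    moreover have "\<epsilon> * s > 0" using \<epsilon> s by simp
    moreover have "(s, 0) \<in> Q" unfolding Q_def using s r by auto
    ultimately show ?thesis using m(2)[of "(s, 0)"] unfolding fst_conv snd_conv by linarith
  qed
  obtain \<sigma> z where mz: "m = (\<sigma>, z)" by (cases m)
  have \<sigma>z: "0 \<le> \<sigma>" "\<sigma> \<le> s1" "norm z \<le> r" using m(1) unfolding mz Q_def by auto
  have k\<sigma>: "k * \<sigma> > - (r / 2)"
  proof -
    have "\<bar>k * \<sigma>\<bar> \<le> \<bar>k\<bar> * s1" unfolding abs_mult using \<sigma>z by (intro mult_left_mono) auto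
    then show ?thesis using s1k by linarith
  qed
  have Rz: "R * norm z \<le> R * r" using \<sigma>z R by (intro mult_left_mono) auto
  have W\<psi>: "W (\<sigma>, z) > U (t, x) + k * \<sigma> + S z + B * \<sigma>\<^sup>2" using pos unfolding mz \<psi>_def by simp
  \<comment> \<open>A positive maximum is interior: at \<open>\<sigma> = 0\<close> the cone
    dominates \<open>U\<close>, at \<open>\<sigma> = s1\<close> the term
    \<open>B * \<sigma>\<^sup>2\<close> wins, and at \<open>norm z = r\<close> the slope surplus
    \<open>R' - R = 1\<close> wins.\<close>
  have \<sigma>0: "\<sigma> > 0"
  proof (rule ccontr)
    assume "\<not> \<sigma> > 0"
    then have "\<sigma> = 0" using \<sigma>z by simp
    then have "W (\<sigma>, z) \<le> U (t, x) + R * norm z" unfolding W_def using lip[of "x + z"] \<sigma>z r by simp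
    moreover have "R * norm z \<le> R' * norm z" unfolding R'_def by (intro mult_right_mono) auto
    then have "R * norm z \<le> S z" using S_ge[of z] by linarith
    ultimately show False using W\<psi> \<open>\<sigma> = 0\<close> by simp
  qed
  have \<sigma>1: "\<sigma> < s1"
  proof (rule ccontr)
    assume "\<not> \<sigma> < s1"
    then have "\<sigma> = s1" using \<sigma>z by simp
    then have "B * \<sigma>\<^sup>2 = R * r + r" using Bs1 by (simp add: algebra_simps)
    then show False using W\<psi> Wt[OF \<sigma>z] k\<sigma> Rz S_pos[of z] by linarith
  qed
  have zr: "norm z < r"
  proof (rule ccontr)
    assume "\<not> norm z < r"
    then have "norm z = r" using \<sigma>z by simp
    then have "S z \<ge> R * r + r" using S_ge[of z] unfolding R'_def by (simp add: algebra_simps)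
    moreover have "B * \<sigma>\<^sup>2 \<ge> 0" using B by simp
    ultimately show False using W\<psi> Wt[OF \<sigma>z] k\<sigma> Rz by linarith
  qed
  \<comment> \<open>Return to fixed coordinates: \<open>\<zeta>\<close> removes the motion along
    \<open>v\<close>, which adds \<open>- v \<bullet> P\<close> to the time derivative of the test
    function.\<close>
  define \<zeta> where "\<zeta> = (\<lambda>y::real \<times> 'a. snd y - x - (fst y - t) *\<^sub>R v)"
  define P where "P = (\<lambda>y. (R'\<^sup>2 / S (\<zeta> y)) *\<^sub>R \<zeta> y)"
  define \<phi> where "\<phi> = (\<lambda>y. \<psi> (fst y - t) (\<zeta> y))"
  define G where "G = (\<lambda>y. (k + 2 * B * (fst y - t) - v \<bullet> P y, P y))"
  have S\<zeta>_deriv: "((\<lambda>y. S (\<zeta> y)) has_derivative (\<lambda>h. P y \<bullet> (snd h - fst h *\<^sub>R v))) (at y)" for y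
  proof -
    have inner_d: "((\<lambda>y. R'\<^sup>2 * (\<zeta> y \<bullet> \<zeta> y) + \<delta>\<^sup>2) has_derivative (\<lambda>h. 2 * R'\<^sup>2 * (\<zeta> y \<bullet> (snd h - fst h *\<^sub>R v)))) (at y)"
      unfolding \<zeta>_def
      by (auto intro!: derivative_eq_intros simp: fun_eq_iff inner_commute algebra_simps)
    have sqrt_d: "(sqrt has_derivative (\<lambda>h. inverse (S (\<zeta> y)) / 2 * h)) (at (R'\<^sup>2 * (\<zeta> y \<bullet> \<zeta> y) + \<delta>\<^sup>2))"
      using DERIV_real_sqrt[OF arg_pos[of "\<zeta> y"]] unfolding has_field_derivative_def S_def .
    have "((\<lambda>y. S (\<zeta> y)) has_derivative
        (\<lambda>h. inverse (S (\<zeta> y)) / 2 * (2 * R'\<^sup>2 * (\<zeta> y \<bullet> (snd h - fst h *\<^sub>R v))))) (at y)"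
      using has_derivative_compose[OF inner_d sqrt_d] unfolding S_def .
    then show ?thesis
      by (rule has_derivative_eq_rhs) (rule ext, simp add: P_def field_simps)
  qed
  have C1: "C1_with_grad \<phi> G"
    unfolding C1_with_grad_def
  proof (intro conjI allI)
    have S_ne: "S z \<noteq> 0" for z using S_pos[of z] by simp
    have "continuous_on UNIV P" unfolding P_def using S_ne
      by (auto simp: \<zeta>_def S_def intro!: continuous_intros)
    then show "continuous_on UNIV G" unfolding G_def by (intro continuous_intros)
    fix y
    have "(\<phi> has_derivative (\<lambda>h. k * fst h + P y \<bullet> (snd h - fst h *\<^sub>R v) + B * (2 * (fst y - t) * fst h))) (at y)"
      unfolding \<phi>_def \<psi>_def
      by (auto intro!: derivative_eq_intros S\<zeta>_deriv)
    then show "(\<phi> has_derivative (\<lambda>h. G y \<bullet> h)) (at y)"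
      by (rule has_derivative_eq_rhs) (simp add: fun_eq_iff G_def inner_prod_def algebra_simps inner_commute)
  qed
  define O' where "O' = {y. t < fst y \<and> fst y < t + s1 \<and> norm (\<zeta> y) < r}"
  have "open O'" unfolding O'_def \<zeta>_def
    by (intro open_Collect_conj open_Collect_less continuous_intros)
  define y0 where "y0 = (t + \<sigma>, x + z + \<sigma> *\<^sub>R v)"
  have \<zeta>y0: "\<zeta> y0 = z" unfolding \<zeta>_def y0_def by simp
  have y0: "y0 \<in> O'" unfolding O'_def using \<zeta>y0 \<sigma>0 \<sigma>1 zr by (simp add: y0_def)
  have UW: "U y = W (fst y - t, \<zeta> y)" for y unfolding W_def \<zeta>_def by simp
  have "G y0 \<in> superdiff U y0"
  proof (rule superdiffI[OF C1 \<open>open O'\<close> y0])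
    fix y assume "y \<in> O'"
    then have "(fst y - t, \<zeta> y) \<in> Q" unfolding O'_def Q_def by auto
    from m(2)[OF this] show "U y - \<phi> y \<le> U y0 - \<phi> y0"
      unfolding UW[of y] UW[of y0] \<phi>_def \<zeta>y0 mz by (simp add: y0_def)
  qed
  from sub[OF _ this] have le0: "k + 2 * B * \<sigma> - v \<bullet> P y0 + H (snd y0) (P y0) \<le> 0"
    unfolding G_def y0_def using t \<sigma>0 by simp
  have nP: "norm (P y0) \<le> R'"
  proof -
    have "norm (P y0) = R'\<^sup>2 * norm z / S z" unfolding P_def \<zeta>y0 using S_pos[of z] by simp
    also have "\<dots> \<le> R'" using S_ge[of z] S_pos[of z] R' by (simp add: field_simps power2_eq_square)
    finally show ?thesis .
  qed
  have "norm (x - snd y0) \<le> 2 * r"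
  proof -
    have "norm (x - snd y0) = norm (z + \<sigma> *\<^sub>R v)" unfolding y0_def 
      by (subst norm_minus_commute) (simp add: algebra_simps)
    also have "\<dots> \<le> norm z + \<sigma> * norm v" using norm_triangle_ineq[of z "\<sigma> *\<^sub>R v"] \<sigma>z by simp
    also have "\<sigma> * norm v \<le> s1 * norm v" using \<sigma>z by (intro mult_right_mono) auto
    finally show ?thesis using s1v \<sigma>z by linarith
  qed
  then have "M * (1 + norm (P y0)) * norm (x - snd y0) \<le> M * (1 + R') * (2 * r)"
    using nP M R' by (intro mult_mono) auto
  then have "H x (P y0) - H (snd y0) (P y0) < \<epsilon>" using Hx[of x "P y0" "snd y0"] rM by linarith
  \<comment> \<open>This turns \<open>le0\<close> into \<open>\<epsilon> + 2 * B * \<sigma> \<le> H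
    x (P y0) - H (snd y0) (P y0)\<close>, whose right side is below
    \<open>\<epsilon>\<close>.\<close>
  moreover have "H x p + v \<bullet> P y0 - p \<bullet> v \<le> H x (P y0)" using v[of "P y0"] by (simp add: inner_diff_right inner_commute)
  moreover have "B * \<sigma> > 0" using B \<sigma>0 by simp
  ultimately show False using le0 unfolding k_def by linarith
qed

section \<open>Discrete evolution\<close>

locale convex_concave_hamiltonian =
  fixes H :: "'a::euclidean_space \<Rightarrow> 'a \<Rightarrow> real" and M :: real
  assumes convH: "\<And>x. convex_on UNIV (\<lambda>p. H x p)"
    and concH: "\<And>p. concave_on UNIV (\<lambda>x. H x p)"
    and M: "M \<ge> 0"
    and growth: "\<And>x p. \<bar>H x p\<bar> \<le> M * (1 + norm x) * (1 + norm p)"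
begin

section \<open>Lipschitz bounds for the Hamiltonian\<close>

lemma H_Lipschitz_momentum: "\<bar>H x p - H x q\<bar> \<le> M * (1 + norm x) * norm (p - q)"
  by (rule convex_linear_growth_Lipschitz[OF convH growth])

lemma H_Lipschitz_space: "\<bar>H x p - H y p\<bar> \<le> M * (1 + norm p) * norm (x - y)"
proof -
  have "convex_on UNIV (\<lambda>x. - H x p)" using concH[of p] unfolding concave_on_def .
  moreover have "\<bar>- H y p\<bar> \<le> M * (1 + norm p) * (1 + norm y)" for y
    using growth[of y p] by (simp add: mult_ac)
  ultimately show ?thesis using convex_linear_growth_Lipschitz[of "\<lambda>x. - H x p" "M * (1 + norm p)" x y] by simp
qed

section \<open>The Lagrangian and the Lax-Oleinik step\<close>

text \<open>Epigraph of the Lagrangian, the convex conjugate of \<open>H x\<close>. Working with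
  pairs \<open>(v, l)\<close> avoids a function with infinite values.\<close>

definition cost_epi :: "'a \<Rightarrow> ('a \<times> real) set" where
  "cost_epi x = {(v, l). \<forall>p. p \<bullet> v - H x p \<le> l}"

lemma cost_epi_ge: "(v, l) \<in> cost_epi x \<Longrightarrow> l \<ge> p \<bullet> v - H x p"
  unfolding cost_epi_def by auto

text \<open>Finite speed: \<open>p \<bullet> v - l\<close> is an affine minorant, in
  \<open>p\<close>, of a function of linear growth.\<close>

lemma cost_epi_velocity_le:
  assumes "(v, l) \<in> cost_epi x"
  shows "norm v \<le> M * (1 + norm x)"
proof (rule affine_minorant_slope_le)
  show "- l + v \<bullet> p \<le> M * (1 + norm x) * (1 + norm p)" for p
    using cost_epi_ge[OF assms, of p] growth[of x p] by (simp add: inner_commute abs_le_iff)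
qed (use M in simp)

text \<open>Equality in the Fenchel inequality for a subgradient \<open>v\<close> of
  \<open>H x\<close> at \<open>p\<close>. It also shows that the epigraph is nonempty.\<close>

lemma cost_epi_attained:
  obtains v where "(v, p \<bullet> v - H x p) \<in> cost_epi x"
proof -
  obtain v where v: "\<And>q. H x p + v \<bullet> (q - p) \<le> H x q"
    using convex_subgradient_exists[OF convH] by blast
  have "q \<bullet> v - H x q \<le> p \<bullet> v - H x p" for q
    using v[of q] by (simp add: inner_diff_right inner_commute)
  then show ?thesis using that[of v] unfolding cost_epi_def by simp
qed

text \<open>For each \<open>p\<close> the map from \<open>(x, v)\<close> to
  \<open>p \<bullet> v - H x p\<close> is jointly convex, because \<open>H\<close> is concave in
  \<open>x\<close>; the Lagrangian is the supremum of these maps.\<close>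

lemma cost_epi_convex:
  assumes "(v, l) \<in> cost_epi x" "(v', l') \<in> cost_epi x'" "0 \<le> u" "u \<le> 1"
  shows "((1 - u) *\<^sub>R v + u *\<^sub>R v', (1 - u) * l + u * l') \<in> cost_epi ((1 - u) *\<^sub>R x + u *\<^sub>R x')"
  unfolding cost_epi_def
proof (clarify)
  fix p
  have "convex_on UNIV (\<lambda>x. - H x p)" using concH[of p] unfolding concave_on_def .
  from convex_onD[OF this assms(3,4), of x x']
  have "- H ((1 - u) *\<^sub>R x + u *\<^sub>R x') p \<le> (1 - u) * - H x p + u * - H x' p" by simp
  moreover have "(1 - u) * (p \<bullet> v - H x p) \<le> (1 - u) * l" "u * (p \<bullet> v' - H x' p) \<le> u * l'"
    using assms cost_epi_ge by (auto intro!: mult_left_mono)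
  ultimately show "p \<bullet> ((1 - u) *\<^sub>R v + u *\<^sub>R v') - H ((1 - u) *\<^sub>R x + u *\<^sub>R x') p \<le> (1 - u) * l + u * l'"
    by (simp add: inner_add_right algebra_simps)
qed

text \<open>The Lax--Oleinik step with the Lagrangian, which takes the value infinity, replaced by its epigraph.\<close>
definition lax_step :: "real \<Rightarrow> ('a \<Rightarrow> real) \<Rightarrow> 'a \<Rightarrow> real" where
  "lax_step h g x = Inf {g (x - h *\<^sub>R v) + h * l | v l. (v, l) \<in> cost_epi x}"

lemma lax_step_ge:
  assumes "\<And>v l. (v, l) \<in> cost_epi x \<Longrightarrow> B \<le> g (x - h *\<^sub>R v) + h * l"
  shows "B \<le> lax_step h g x"
  unfolding lax_step_def
proof (rule cInf_greatest)
  obtain v where "(v, 0 \<bullet> v - H x 0) \<in> cost_epi x" by (rule cost_epi_attained)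
  then show "{g (x - h *\<^sub>R v) + h * l | v l. (v, l) \<in> cost_epi x} \<noteq> {}" by blast
qed (use assms in blast)

text \<open>The infimum is over a set bounded below: finite speed confines
  \<open>x - h *\<^sub>R v\<close> to a compact ball, and the momentum 0 gives
  \<open>l \<ge> - H x 0\<close>.\<close>

lemma lax_step_le:
  assumes g: "continuous_on UNIV g" and h: "h \<ge> 0" and vl: "(v, l) \<in> cost_epi x"
  shows "lax_step h g x \<le> g (x - h *\<^sub>R v) + h * l"
  unfolding lax_step_def
proof (rule cInf_lower)
  show "g (x - h *\<^sub>R v) + h * l \<in> {g (x - h *\<^sub>R v) + h * l | v l. (v, l) \<in> cost_epi x}"
    using vl by blast
  define r where "r = h * (M * (1 + norm x))"
  have "compact (g ` cball x r)"
    by (intro compact_continuous_image continuous_on_subset[OF g]) auto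
  then have "bounded (g ` cball x r)" by (rule compact_imp_bounded)
  then obtain B where "\<forall>b\<in>g ` cball x r. norm b \<le> B" unfolding bounded_iff by blast
  then have B: "\<bar>g y\<bar> \<le> B" if "y \<in> cball x r" for y using that by simp
  show "bdd_below {g (x - h *\<^sub>R v) + h * l | v l. (v, l) \<in> cost_epi x}"
  proof (rule bdd_belowI)
    fix b assume "b \<in> {g (x - h *\<^sub>R v) + h * l | v l. (v, l) \<in> cost_epi x}"
    then obtain v l where b: "b = g (x - h *\<^sub>R v) + h * l" and vl: "(v, l) \<in> cost_epi x" by blast
    have "norm (h *\<^sub>R v) \<le> r" unfolding r_def
      using cost_epi_velocity_le[OF vl] h by (simp add: mult_left_mono)
    then have "g (x - h *\<^sub>R v) \<ge> - B" using B[of "x - h *\<^sub>R v"] by (simp add: dist_norm)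
    moreover have "h * l \<ge> h * - H x 0" using cost_epi_ge[OF vl, of 0] h by (intro mult_left_mono) auto
    ultimately show "- B + h * - H x 0 \<le> b" unfolding b by linarith
  qed
qed

text \<open>Partial minimisation of a jointly convex function: a convex combination of competitors
  at \<open>x\<close> and \<open>y\<close> is a competitor at the intermediate point.\<close>

lemma convex_lax_step:
  assumes g: "convex_on UNIV g" and h: "h \<ge> 0"
  shows "convex_on UNIV (lax_step h g)"
proof (rule convex_onI)
  have cont: "continuous_on UNIV g" using g by (simp add: convex_on_continuous)
  fix u :: real and x y :: 'a
  assume u: "0 < u" "u < 1"
  define z where "z = (1 - u) *\<^sub>R x + u *\<^sub>R y"
  have 1: "lax_step h g z \<le> (1 - u) * (g (x - h *\<^sub>R v) + h * l) + u * (g (y - h *\<^sub>R v') + h * l')"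
    if "(v, l) \<in> cost_epi x" "(v', l') \<in> cost_epi y" for v l v' l'
  proof -
    let ?v = "(1 - u) *\<^sub>R v + u *\<^sub>R v'" and ?l = "(1 - u) * l + u * l'"
    have "(?v, ?l) \<in> cost_epi z" unfolding z_def using cost_epi_convex[OF that] u by simp
    then have le: "lax_step h g z \<le> g (z - h *\<^sub>R ?v) + h * ?l" by (rule lax_step_le[OF cont h])
    have zv: "z - h *\<^sub>R ?v = (1 - u) *\<^sub>R (x - h *\<^sub>R v) + u *\<^sub>R (y - h *\<^sub>R v')"
      unfolding z_def by (simp add: algebra_simps)
    have "g ((1 - u) *\<^sub>R (x - h *\<^sub>R v) + u *\<^sub>R (y - h *\<^sub>R v')) \<le> (1 - u) * g (x - h *\<^sub>R v) + u * g (y - h *\<^sub>R v')"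
      using convex_onD[OF g] u by simp
    moreover have "h * ?l = (1 - u) * (h * l) + u * (h * l')" by (simp add: algebra_simps)
    ultimately show ?thesis using le unfolding zv distrib_left by linarith
  qed
  \<comment> \<open>The two infima are taken one after the other, first over the competitors at
    \<open>y\<close> with the one at \<open>x\<close> fixed.\<close>
  have 2: "(lax_step h g z - (1 - u) * (g (x - h *\<^sub>R v) + h * l)) / u \<le> lax_step h g y"
    if "(v, l) \<in> cost_epi x" for v l
  proof (rule lax_step_ge)
    fix v' l' assume "(v', l') \<in> cost_epi y"
    from 1[OF that this] show "(lax_step h g z - (1 - u) * (g (x - h *\<^sub>R v) + h * l)) / u \<le> g (y - h *\<^sub>R v') + h * l'"
      using u by (simp add: field_simps)
  qed
  have "(lax_step h g z - u * lax_step h g y) / (1 - u) \<le> lax_step h g x"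
  proof (rule lax_step_ge)
    fix v l assume "(v, l) \<in> cost_epi x"
    from 2[OF this] show "(lax_step h g z - u * lax_step h g y) / (1 - u) \<le> g (x - h *\<^sub>R v) + h * l"
      using u by (simp add: field_simps)
  qed
  then show "lax_step h g ((1 - u) *\<^sub>R x + u *\<^sub>R y) \<le> (1 - u) * lax_step h g x + u * lax_step h g y"
    using u unfolding z_def by (simp add: field_simps)
qed simp

lemma convex_lax_iter:
  assumes "convex_on UNIV g" "h \<ge> 0"
  shows "convex_on UNIV ((lax_step h ^^ n) g)"
  by (induction n) (auto simp: assms intro: convex_lax_step)

text \<open>A trajectory with speed at most \<open>M (1 + norm)\<close> stays within this distance of \<open>x\<close> up to time \<open>s\<close>.\<close>
definition reach :: "real \<Rightarrow> 'a \<Rightarrow> real" where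
  "reach s x = (exp (M * s) - 1) * (1 + norm x)"

lemma reach_nonneg: "s \<ge> 0 \<Longrightarrow> reach s x \<ge> 0"
  unfolding reach_def using M by simp

text \<open>A discrete Gronwall step resting on \<open>1 + M * h \<le> exp (M * h)\<close>; it
  closes the inductions over the number of steps.\<close>

lemma reach_step:
  assumes v: "norm v \<le> M * (1 + norm x)" and "h \<ge> 0" "s \<ge> 0"
  shows "reach s (x - h *\<^sub>R v) + h * norm v \<le> reach (s + h) x"
proof -
  define E where "E = exp (M * s)"
  define X where "X = 1 + norm x"
  have E: "E \<ge> 1" unfolding E_def using M assms by simp
  have hv: "h * norm v \<le> h * M * X" unfolding X_def using mult_left_mono[OF v \<open>h \<ge> 0\<close>] by (simp add: mult_ac)
  have "1 + norm (x - h *\<^sub>R v) \<le> X * (1 + h * M)"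
    using norm_triangle_ineq4[of x "h *\<^sub>R v"] hv assms unfolding X_def by (simp add: algebra_simps)
  then have "reach s (x - h *\<^sub>R v) \<le> (E - 1) * (X * (1 + h * M))"
    unfolding reach_def E_def[symmetric] using E by (intro mult_left_mono) auto
  moreover have "E * (1 + h * M) * X \<le> E * exp (M * h) * X"
    using exp_ge_add_one_self[of "M * h"] E unfolding X_def
    by (intro mult_right_mono mult_left_mono) (auto simp: mult.commute)
  ultimately show ?thesis using hv
    unfolding reach_def E_def[symmetric] X_def[symmetric] distrib_left exp_add by (simp add: algebra_simps)
qed

section \<open>Propagation of affine bounds through the iterated step\<close>

text \<open>Moving from \<open>x\<close> to \<open>x - h *\<^sub>R v\<close> changes the affine part
  by \<open>h * (p \<bullet> v)\<close>, which the cost \<open>h * l\<close> returns up to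
  \<open>h * H x p\<close>. As \<open>reach\<close> is of the order of the elapsed time, the error
  is of second order.\<close>

lemma lax_iter_ge:
  assumes h: "h \<ge> 0"
    and B: "\<And>y. norm (y - x) \<le> reach (real n * h) x \<Longrightarrow> B \<le> g y + p \<bullet> (x - y)"
  shows "B - real n * h * (H x p + M * (1 + norm p) * reach (real n * h) x) \<le> (lax_step h ^^ n) g x"
  using B
proof (induction n arbitrary: x B)
  case 0
  from 0[of x] show ?case by (simp add: reach_def)
next
  case (Suc n)
  define s where "s = real n * h"
  have s: "s \<ge> 0" "real (Suc n) * h = s + h" unfolding s_def using h by (auto simp: algebra_simps)
  define C where "C = M * (1 + norm p)"
  have C: "C \<ge> 0" unfolding C_def using M by simp
  show ?case unfolding funpow.simps comp_apply
  proof (rule lax_step_ge)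
    fix v l assume vl: "(v, l) \<in> cost_epi x"
    define x' where "x' = x - h *\<^sub>R v"
    note R = reach_step[OF cost_epi_velocity_le[OF vl] h s(1), folded x'_def]
    have xx': "norm (x' - x) = h * norm v" unfolding x'_def using h by simp
    have "B - h * (p \<bullet> v) - s * (H x' p + C * reach s x') \<le> (lax_step h ^^ n) g x'"
      unfolding s_def C_def
    proof (rule Suc.IH)
      fix y assume "norm (y - x') \<le> reach (real n * h) x'"
      then have "norm (y - x) \<le> reach (s + h) x"
        using R xx' norm_triangle_ineq[of "y - x'" "x' - x"] unfolding s_def by simp
      then have "B \<le> g y + p \<bullet> (x - y)" using Suc.prems[of y] unfolding s(2) by simp
      then show "B - h * (p \<bullet> v) \<le> g y + p \<bullet> (x' - y)"
        unfolding x'_def by (simp add: algebra_simps inner_diff_right)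
    qed
    moreover have "h * l \<ge> h * (p \<bullet> v - H x p)" using cost_epi_ge[OF vl] h by (intro mult_left_mono) auto
    moreover have "s * (H x' p + C * reach s x') \<le> s * (H x p + C * reach (s + h) x)"
    proof (rule mult_left_mono)
      \<comment> \<open>The change of \<open>H\<close> over the distance \<open>h * norm v\<close>
        is paid for by the larger reach at \<open>x\<close>.\<close>
      have "H x' p - H x p \<le> C * (h * norm v)"
        using H_Lipschitz_space[of x' p x] unfolding C_def xx' by linarith
      moreover have "C * (reach s x' + h * norm v) \<le> C * reach (s + h) x" using R C by (rule mult_left_mono)
      ultimately show "H x' p + C * reach s x' \<le> H x p + C * reach (s + h) x" by (simp add: algebra_simps)
    qed fact
    moreover have "h * (C * reach (s + h) x) \<ge> 0" using h s C reach_nonneg[of "s + h" x] by simp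
    ultimately show "B - real (Suc n) * h * (H x p + M * (1 + norm p) * reach (real (Suc n) * h) x)
       \<le> (lax_step h ^^ n) g (x - h *\<^sub>R v) + h * l"
      unfolding s(2) C_def[symmetric] x'_def[symmetric] by (simp add: algebra_simps)
  qed
qed

text \<open>Dual to the lower bound: each step uses the velocity for which the Fenchel inequality at
  \<open>p\<close> is an equality. Convexity of \<open>g\<close> supplies the continuity of the
  iterates.\<close>

lemma lax_iter_le:
  assumes h: "h \<ge> 0" and g: "convex_on UNIV g"
    and B: "\<And>y. norm (y - x) \<le> reach (real n * h) x \<Longrightarrow> g y + p \<bullet> (x - y) \<le> B"
  shows "(lax_step h ^^ n) g x \<le> B - real n * h * (H x p - M * (1 + norm p) * reach (real n * h) x)"
  using B
proof (induction n arbitrary: x B)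
  case 0
  from 0[of x] show ?case by (simp add: reach_def)
next
  case (Suc n)
  define s where "s = real n * h"
  have s: "s \<ge> 0" "real (Suc n) * h = s + h" unfolding s_def using h by (auto simp: algebra_simps)
  define C where "C = M * (1 + norm p)"
  have C: "C \<ge> 0" unfolding C_def using M by simp
  obtain v where vl: "(v, p \<bullet> v - H x p) \<in> cost_epi x" by (rule cost_epi_attained)
  define x' where "x' = x - h *\<^sub>R v"
  note R = reach_step[OF cost_epi_velocity_le[OF vl] h s(1), folded x'_def]
  have xx': "norm (x' - x) = h * norm v" unfolding x'_def using h by simp
  have "(lax_step h ^^ n) g x' \<le> B - h * (p \<bullet> v) - s * (H x' p - C * reach s x')"
    unfolding s_def C_def
  proof (rule Suc.IH)
    fix y assume "norm (y - x') \<le> reach (real n * h) x'"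
    then have "norm (y - x) \<le> reach (s + h) x"
      using R xx' norm_triangle_ineq[of "y - x'" "x' - x"] unfolding s_def by simp
    then have "g y + p \<bullet> (x - y) \<le> B" using Suc.prems[of y] unfolding s(2) by simp
    then show "g y + p \<bullet> (x' - y) \<le> B - h * (p \<bullet> v)"
      unfolding x'_def by (simp add: algebra_simps inner_diff_right)
  qed
  moreover have "lax_step h ((lax_step h ^^ n) g) x \<le> (lax_step h ^^ n) g x' + h * (p \<bullet> v - H x p)"
    unfolding x'_def
    by (rule lax_step_le[OF _ h vl]) (simp add: convex_on_continuous convex_lax_iter[OF g h])
  moreover have "s * (H x p - C * reach (s + h) x) \<le> s * (H x' p - C * reach s x')"
  proof (rule mult_left_mono)
    have "H x p - H x' p \<le> C * (h * norm v)"
      using H_Lipschitz_space[of x p x'] unfolding C_def xx'[symmetric] norm_minus_commute[of x x'] by linarith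
    moreover have "C * (reach s x' + h * norm v) \<le> C * reach (s + h) x" using R C by (rule mult_left_mono)
    ultimately show "H x p - C * reach (s + h) x \<le> H x' p - C * reach s x'" by (simp add: algebra_simps)
  qed fact
  moreover have "h * (C * reach (s + h) x) \<ge> 0" using h s C reach_nonneg[of "s + h" x] by simp
  ultimately show ?case
    unfolding s(2) C_def[symmetric] funpow.simps comp_apply by (simp add: algebra_simps)
qed

end

section \<open>Limit of the discrete evolution\<close>

text \<open>A diagonal subsequence converges on a countable dense set, and equicontinuity extends
  this to all points. Equicontinuity is asked only for large \<open>n\<close>, because the
  approximations jump in time.\<close>

lemma asymptotically_equicontinuous_subsequence:
  fixes f :: "nat \<Rightarrow> 'b::{metric_space, second_countable_topology} \<Rightarrow> real"
  assumes bdd: "\<And>z. \<exists>B. \<forall>n. \<bar>f n z\<bar> \<le> B"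
    and eqc: "\<And>z e. 0 < e \<Longrightarrow> \<exists>d>0. \<forall>\<^sub>F n in sequentially. \<forall>y. dist y z < d \<longrightarrow> \<bar>f n y - f n z\<bar> < e"
  obtains k g where "strict_mono (k :: nat \<Rightarrow> nat)" "continuous_on UNIV g"
    "\<And>K e. compact K \<Longrightarrow> 0 < e \<Longrightarrow> \<forall>\<^sub>F n in sequentially. \<forall>z\<in>K. \<bar>f (k n) z - g z\<bar> < e"
proof -
  obtain D :: "'b set" where D: "countable D" "\<And>X. open X \<Longrightarrow> X \<noteq> {} \<Longrightarrow> \<exists>d\<in>D. d \<in> X"
    using countable_dense_exists by blast
  obtain B where B: "\<And>z n. \<bar>f n z\<bar> \<le> B z" using bdd by metis
  have B1: "1 + B z > 0" for z using B[of 0 z] by linarith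
  \<comment> \<open>The bound depends on \<open>z\<close>; dividing by \<open>1 + B z\<close> makes
    it uniform for the diagonal argument.\<close>
  have "norm (f n z / (1 + B z)) \<le> 1" for n z
    using B[of n z] B1[of z] by (simp add: field_simps)
  then obtain k where k: "strict_mono (k :: nat \<Rightarrow> nat)"
    and conv: "\<And>z. z \<in> D \<Longrightarrow> \<exists>l. (\<lambda>n. f (k n) z / (1 + B z)) \<longlonglongrightarrow> l"
    using function_convergent_subsequence[OF D(1), of "\<lambda>n z. f n z / (1 + B z)" 1] by blast
  have convD: "convergent (\<lambda>n. f (k n) z)" if zD: "z \<in> D" for z
  proof -
    obtain l where "(\<lambda>n. f (k n) z / (1 + B z)) \<longlonglongrightarrow> l" using conv[OF zD] by blast
    from tendsto_mult_right[OF this, of "1 + B z"] B1[of z] show ?thesis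
      by (auto simp: convergent_def)
  qed
  have eqck: "\<exists>d>0. \<forall>\<^sub>F n in sequentially. \<forall>y. dist y z < d \<longrightarrow> \<bar>f (k n) y - f (k n) z\<bar> < e"
    if "0 < e" for z e
    using eqc[OF that, of z] eventually_subseq[OF k] by blast
  have conv_all: "convergent (\<lambda>n. f (k n) z)" for z
  proof (rule Cauchy_convergent, rule metric_CauchyI)
    fix e :: real assume e: "e > 0"
    then obtain d where d: "d > 0" and ev: "\<forall>\<^sub>F n in sequentially. \<forall>y. dist y z < d \<longrightarrow> \<bar>f (k n) y - f (k n) z\<bar> < e / 3"
      using eqck[of "e / 3" z] by auto
    obtain y where y: "y \<in> D" "y \<in> ball z d" using D(2)[of "ball z d"] d by auto
    obtain N1 where N1: "\<And>n. n \<ge> N1 \<Longrightarrow> \<bar>f (k n) y - f (k n) z\<bar> < e / 3"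
      using ev y unfolding eventually_sequentially by (auto simp: dist_commute)
    obtain N2 where N2: "\<And>m n. m \<ge> N2 \<Longrightarrow> n \<ge> N2 \<Longrightarrow> dist (f (k m) y) (f (k n) y) < e / 3"
      using metric_CauchyD[OF convergent_Cauchy[OF convD[OF y(1)]], of "e / 3"] e by auto
    show "\<exists>N. \<forall>m\<ge>N. \<forall>n\<ge>N. dist (f (k m) z) (f (k n) z) < e"
    proof (intro exI allI impI)
      fix m n assume "max N1 N2 \<le> m" "max N1 N2 \<le> n"
      then have mn: "N1 \<le> m" "N1 \<le> n" "N2 \<le> m" "N2 \<le> n" by simp_all
      show "dist (f (k m) z) (f (k n) z) < e"
        using N1[OF mn(1)] N1[OF mn(2)] N2[OF mn(3,4)] unfolding dist_real_def by linarith
    qed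
  qed
  define g where "g = (\<lambda>z. lim (\<lambda>n. f (k n) z))"
  have g: "(\<lambda>n. f (k n) z) \<longlonglongrightarrow> g z" for z
    unfolding g_def using conv_all[of z] by (simp add: convergent_LIMSEQ_iff)
  have g_eqc: "\<bar>g y - g z\<bar> \<le> e"
    if "\<forall>\<^sub>F n in sequentially. \<forall>y. dist y z < d \<longrightarrow> \<bar>f (k n) y - f (k n) z\<bar> < e" "dist y z < d" for y z d e
  proof (rule tendsto_upperbound)
    show "(\<lambda>n. \<bar>f (k n) y - f (k n) z\<bar>) \<longlonglongrightarrow> \<bar>g y - g z\<bar>" by (intro tendsto_intros g)
    show "\<forall>\<^sub>F n in sequentially. \<bar>f (k n) y - f (k n) z\<bar> \<le> e"
      using that(1) by eventually_elim (use that(2) in force)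
  qed simp
  have g_cont: "\<exists>d>0. \<forall>y. dist y z < d \<longrightarrow> dist (g y) (g z) < e" if e: "e > 0" for z e
  proof -
    have e2: "e / 2 > 0" using e by simp
    obtain d where d: "d > 0" and ev: "\<forall>\<^sub>F n in sequentially. \<forall>y. dist y z < d \<longrightarrow> \<bar>f (k n) y - f (k n) z\<bar> < e / 2"
      using eqck[OF e2, of z] by blast
    have "dist (g y) (g z) < e" if "dist y z < d" for y
      using g_eqc[OF ev that] e by (simp add: dist_real_def)
    with d show ?thesis by blast
  qed
  have g_continuous: "continuous_on UNIV g" unfolding continuous_on_iff using g_cont by simp
  have unif: "\<forall>\<^sub>F n in sequentially. \<forall>z\<in>K. \<bar>f (k n) z - g z\<bar> < e" if K: "compact K" and e: "0 < e" for K e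
  proof -
    have e3: "e / 3 > 0" using e by simp
    have "\<forall>z. \<exists>d. 0 < d \<and> (\<forall>\<^sub>F n in sequentially. \<forall>y. dist y z < d \<longrightarrow> \<bar>f (k n) y - f (k n) z\<bar> < e / 3)"
      by (rule allI) (rule eqck[OF e3])
    from choice[OF this] obtain d where dd: "\<forall>z. 0 < d z \<and> (\<forall>\<^sub>F n in sequentially. \<forall>y. dist y z < d z \<longrightarrow> \<bar>f (k n) y - f (k n) z\<bar> < e / 3)" ..
    have d: "d z > 0" for z using dd by blast
    have ev: "\<forall>\<^sub>F n in sequentially. \<forall>y. dist y z < d z \<longrightarrow> \<bar>f (k n) y - f (k n) z\<bar> < e / 3" for z
      using dd by blast
    \<comment> \<open>Finitely many balls of equicontinuity cover \<open>K\<close>, so convergence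
      at their centres gives uniform convergence.\<close>
    obtain F where F: "F \<subseteq> K" "finite F" "K \<subseteq> (\<Union>z\<in>F. ball z (d z))"
    proof (rule compactE_image[OF K, of K "\<lambda>z. ball z (d z)"])
      show "K \<subseteq> (\<Union>c\<in>K. ball c (d c))" using d by force
    qed auto
    have "\<forall>\<^sub>F n in sequentially. \<forall>z\<in>F. (\<forall>y. dist y z < d z \<longrightarrow> \<bar>f (k n) y - f (k n) z\<bar> < e / 3)
         \<and> \<bar>f (k n) z - g z\<bar> < e / 3"
    proof (intro eventually_ball_finite[OF F(2)] ballI eventually_conj ev)
      fix z
      show "\<forall>\<^sub>F n in sequentially. \<bar>f (k n) z - g z\<bar> < e / 3"
        using tendstoD[OF g[of z], of "e / 3"] e unfolding dist_real_def by simp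
    qed
    then show ?thesis
    proof eventually_elim
      case (elim n)
      show ?case
      proof
        fix y assume "y \<in> K"
        then obtain z where z: "z \<in> F" "dist y z < d z" using F(3) by (auto simp: dist_commute)
        then have "\<bar>f (k n) y - f (k n) z\<bar> < e / 3" "\<bar>f (k n) z - g z\<bar> < e / 3" using elim by auto
        moreover have "\<bar>g y - g z\<bar> \<le> e / 3" by (rule g_eqc[OF ev z(2)])
        ultimately show "\<bar>f (k n) y - g y\<bar> < e" by linarith
      qed
    qed
  qed
  show ?thesis by (rule that[OF k g_continuous unif])
qed

context convex_concave_hamiltonian
begin

section \<open>Approximate solutions and their uniform estimates\<close>

text \<open>Piecewise constant in time, with steps of size \<open>1 / real (Suc k)\<close>. At
  negative times \<open>nat\<close> yields no step and the value is that of \<open>g\<close>, so the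
  approximation lives on all of space-time.\<close>

definition approx_sol :: "('a \<Rightarrow> real) \<Rightarrow> nat \<Rightarrow> real \<times> 'a \<Rightarrow> real" where
  "approx_sol g k z = (lax_step (1 / real (Suc k)) ^^ nat \<lfloor>fst z * real (Suc k)\<rfloor>) g (snd z)"

lemma convex_approx_sol: "convex_on UNIV g \<Longrightarrow> convex_on UNIV (\<lambda>x. approx_sol g k (t, x))"
  unfolding approx_sol_def by (simp add: convex_lax_iter)

text \<open>The semigroup property up to one step of rounding. The lower bound on the elapsed time
  asks for \<open>a \<ge> 0\<close>, because negative times contribute no steps.\<close>

lemma approx_sol_later:
  assumes "a \<le> b"
  obtains m where "\<And>x. approx_sol g k (b, x) = (lax_step (1 / real (Suc k)) ^^ m) (\<lambda>x. approx_sol g k (a, x)) x"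
    "real m * (1 / real (Suc k)) \<le> b - a + 1 / real (Suc k)"
    "a \<ge> 0 \<Longrightarrow> real m * (1 / real (Suc k)) \<ge> b - a - 1 / real (Suc k)"
proof -
  define N where "N = real (Suc k)"
  have N: "N > 0" unfolding N_def by simp
  define i where "i = nat \<lfloor>a * N\<rfloor>"
  define j where "j = nat \<lfloor>b * N\<rfloor>"
  have ab: "a * N \<le> b * N" using assms N by simp
  have ij: "i \<le> j" unfolding i_def j_def using ab by (intro nat_mono floor_mono)
  have up: "real (j - i) \<le> (b - a) * N + 1"
  proof (cases "b \<ge> 0")
    case True
    then have "real j \<le> b * N" unfolding j_def using N by (simp add: of_nat_floor)
    moreover have "real i \<ge> a * N - 1" unfolding i_def by linarith
    ultimately show ?thesis using ij by (simp add: of_nat_diff algebra_simps)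
  next
    case False
    then have "b * N < 0" using N by (simp add: mult_neg_pos)
    then have "j = 0" unfolding j_def by simp
    then show ?thesis using ab by (simp add: algebra_simps)
  qed
  have lo: "real (j - i) \<ge> (b - a) * N - 1" if "a \<ge> 0"
  proof -
    have "real i \<le> a * N" unfolding i_def using N that by (simp add: of_nat_floor)
    moreover have "real j \<ge> b * N - 1" unfolding j_def by linarith
    ultimately show ?thesis using ij by (simp add: of_nat_diff algebra_simps)
  qed
  show ?thesis
  proof (rule that[of "j - i"])
    show "approx_sol g k (b, x) = (lax_step (1 / real (Suc k)) ^^ (j - i)) (\<lambda>x. approx_sol g k (a, x)) x" for x
    proof -
      have "lax_step (1 / N) ^^ j = (lax_step (1 / N) ^^ (j - i)) \<circ> (lax_step (1 / N) ^^ i)"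
        using ij by (metis funpow_add le_add_diff_inverse2)
      then show ?thesis unfolding approx_sol_def N_def[symmetric] fst_conv snd_conv i_def[symmetric] j_def[symmetric]
        by (simp add: eta_contract_eq)
    qed
    show "real (j - i) * (1 / real (Suc k)) \<le> b - a + 1 / real (Suc k)"
      using up N unfolding N_def[symmetric] by (simp add: field_simps)
    show "real (j - i) * (1 / real (Suc k)) \<ge> b - a - 1 / real (Suc k)" if "a \<ge> 0"
    proof -
      have "((b - a) * N - 1) * (1 / N) \<le> real (j - i) * (1 / N)"
        using lo[OF that] N by (intro mult_right_mono) auto
      then show ?thesis using N unfolding N_def[symmetric] by (simp add: left_diff_distrib diff_divide_distrib)
    qed
  qed
qed

text \<open>The propagation estimates with \<open>p = 0\<close>: finite speed restricts the values
  of \<open>g\<close> involved to one ball, whatever the step size.\<close>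

lemma approx_sol_bounded:
  assumes g: "convex_on UNIV g" and T: "T \<ge> 0" and R: "R \<ge> 0"
  obtains B where "\<And>k t x. t \<le> T \<Longrightarrow> norm x \<le> R \<Longrightarrow> \<bar>approx_sol g k (t, x)\<bar> \<le> B"
proof -
  define \<rho> where "\<rho> = (exp (M * T) - 1) * (1 + R)"
  have \<rho>0: "\<rho> \<ge> 0" unfolding \<rho>_def using M T R by simp
  have "continuous_on UNIV g" using g by (simp add: convex_on_continuous)
  then have "compact (g ` cball 0 (R + \<rho>))"
    by (intro compact_continuous_image) (auto intro: continuous_on_subset)
  then have "bounded (g ` cball 0 (R + \<rho>))" by (rule compact_imp_bounded)
  then obtain b where "\<forall>y\<in>g ` cball 0 (R + \<rho>). norm y \<le> b" unfolding bounded_iff by blast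
  then have b: "\<bar>g y\<bar> \<le> b" if "norm y \<le> R + \<rho>" for y using that by simp
  show ?thesis
  proof (rule that[of "b + T * (M * (1 + R) + M * \<rho>)"])
    fix k t and x :: 'a assume t: "t \<le> T" and x: "norm x \<le> R"
    define h where "h = 1 / real (Suc k)"
    define n where "n = nat \<lfloor>t * real (Suc k)\<rfloor>"
    have h: "h > 0" unfolding h_def by simp
    have nh: "0 \<le> real n * h" "real n * h \<le> T"
    proof -
      show "0 \<le> real n * h" using h by simp
      show "real n * h \<le> T"
      proof (cases "t \<ge> 0")
        case True
        then have "real n \<le> t * real (Suc k)" unfolding n_def by (simp add: of_nat_floor)
        then have "real n * h \<le> t" unfolding h_def by (simp add: field_simps)
        then show ?thesis using t by simp
      next
        case False
        then have "t * real (Suc k) < 0" by (simp add: mult_neg_pos)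
        then show ?thesis using T unfolding n_def by simp
      qed
    qed
    have re: "reach (real n * h) x \<le> \<rho>" "reach (real n * h) x \<ge> 0"
    proof -
      show "reach (real n * h) x \<le> \<rho>" unfolding reach_def \<rho>_def
        using nh M x T by (intro mult_mono) (auto simp: mult_left_mono)
      show "reach (real n * h) x \<ge> 0" by (rule reach_nonneg[OF nh(1)])
    qed
    have yb: "\<bar>g y\<bar> \<le> b" if "norm (y - x) \<le> reach (real n * h) x" for y
      using that re x norm_triangle_ineq[of "y - x" x] by (intro b) simp
    have Hx0: "\<bar>H x 0\<bar> \<le> M * (1 + R)"
      using growth[of x 0] mult_left_mono[OF x M] by (simp add: algebra_simps)
    have err: "real n * h * c \<le> T * (M * (1 + R) + M * \<rho>)"
      if "c \<le> M * (1 + R) + M * reach (real n * h) x" for c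
    proof -
      have "M * reach (real n * h) x \<le> M * \<rho>" using re M by (intro mult_left_mono) auto
      then have "real n * h * c \<le> real n * h * (M * (1 + R) + M * \<rho>)"
        using that nh by (intro mult_left_mono) auto
      also have "\<dots> \<le> T * (M * (1 + R) + M * \<rho>)"
        using nh M R \<rho>0 by (intro mult_right_mono) auto
      finally show ?thesis .
    qed
    have "- b - real n * h * (H x 0 + M * (1 + norm (0::'a)) * reach (real n * h) x) \<le> (lax_step h ^^ n) g x"
      by (rule lax_iter_ge) (use h yb in \<open>auto simp: abs_le_iff\<close>, smt (verit) yb)
    moreover have "(lax_step h ^^ n) g x \<le> b - real n * h * (H x 0 - M * (1 + norm (0::'a)) * reach (real n * h) x)"
      by (rule lax_iter_le) (use h g yb in \<open>auto simp: abs_le_iff\<close>)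
    moreover have "real n * h * (H x 0 + M * reach (real n * h) x) \<le> T * (M * (1 + R) + M * \<rho>)"
      using Hx0 by (intro err) auto
    moreover have "real n * h * (- (H x 0 - M * reach (real n * h) x)) \<le> T * (M * (1 + R) + M * \<rho>)"
      using Hx0 by (intro err) auto
    ultimately show "\<bar>approx_sol g k (t, x)\<bar> \<le> b + T * (M * (1 + R) + M * \<rho>)"
      unfolding approx_sol_def fst_conv snd_conv h_def[symmetric] n_def[symmetric] by (simp add: abs_le_iff algebra_simps)
  qed
qed


text \<open>Convexity in \<open>x\<close> turns the uniform bound on a larger ball into a Lipschitz
  constant independent of \<open>k\<close>.\<close>

lemma approx_sol_Lipschitz:
  assumes g: "convex_on UNIV g" and T: "T \<ge> 0" and R: "R \<ge> 0"
  obtains C where "C \<ge> 0" "\<And>k t x y. t \<le> T \<Longrightarrow> norm x \<le> R \<Longrightarrow> norm y \<le> R \<Longrightarrow>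
    \<bar>approx_sol g k (t, x) - approx_sol g k (t, y)\<bar> \<le> C * norm (x - y)"
proof -
  have "R + 1 \<ge> 0" using R by simp
  from approx_sol_bounded[OF g T this]
  obtain B where B: "\<And>k t x. t \<le> T \<Longrightarrow> norm x \<le> R + 1 \<Longrightarrow> \<bar>approx_sol g k (t, x)\<bar> \<le> B" by blast
  have "B \<ge> 0" using B[of 0 0] R T by fastforce
  then show ?thesis
    using that[of "2 * B"] convex_bounded_Lipschitz[OF convex_approx_sol[OF g], where R = R and B = B] B by simp
qed

text \<open>The space variable is handled by the Lipschitz bound, the time variable by the
  propagation estimates with \<open>p = 0\<close> started at the earlier time. Large
  \<open>k\<close> are needed because of the rounding in time.\<close>

lemma approx_sol_equicontinuous:
  assumes g: "convex_on UNIV g" and e: "e > 0"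
  shows "\<exists>d>0. \<forall>\<^sub>F k in sequentially. \<forall>z'. dist z' z < d \<longrightarrow> \<bar>approx_sol g k z' - approx_sol g k z\<bar> < e"
proof -
  obtain t x where z: "z = (t, x)" by (cases z)
  \<comment> \<open>One unit for the distance from \<open>x\<close> to the nearby point, one for the
    distance travelled, which is at most \<open>\<rho> \<sigma> < 1\<close>.\<close>
  define R where "R = norm x + 2"
  define T where "T = \<bar>t\<bar> + 1"
  have "T \<ge> 0" "R \<ge> 0" unfolding T_def R_def by auto
  from approx_sol_Lipschitz[OF g this] obtain C where C: "C \<ge> 0"
    and lip: "\<And>k t x y. t \<le> T \<Longrightarrow> norm x \<le> R \<Longrightarrow> norm y \<le> R \<Longrightarrow>
    \<bar>approx_sol g k (t, x) - approx_sol g k (t, y)\<bar> \<le> C * norm (x - y)" by blast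
  define \<rho> where "\<rho> = (\<lambda>s. (exp (M * s) - 1) * (1 + R))"
  \<comment> \<open>Modulus in time: the first term is the spatial variation over the reach, the
    second bounds the contribution of \<open>H\<close>.\<close>
  define \<omega> where "\<omega> = (\<lambda>s. C * \<rho> s + s * (M * (1 + R) + M * \<rho> s))"
  have "(\<rho> \<longlongrightarrow> (exp (M * 0) - 1) * (1 + R)) (at_right 0)" unfolding \<rho>_def by (intro tendsto_intros)
  then have \<rho>_lim: "(\<rho> \<longlongrightarrow> 0) (at_right 0)" by simp
  have "(\<omega> \<longlongrightarrow> C * 0 + 0 * (M * (1 + R) + M * 0)) (at_right 0)"
    unfolding \<omega>_def by (intro tendsto_intros \<rho>_lim)
  then have \<omega>_lim: "(\<omega> \<longlongrightarrow> 0) (at_right 0)" by simp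
  have "\<forall>\<^sub>F s in at_right 0. \<rho> s < 1 \<and> \<omega> s < e / 2"
    using order_tendstoD(2)[OF \<rho>_lim, of 1] order_tendstoD(2)[OF \<omega>_lim, of "e / 2"] e
    by (intro eventually_conj) auto
  then obtain s0 where s0: "s0 > 0" and s0b: "\<And>s. 0 < s \<Longrightarrow> s < s0 \<Longrightarrow> \<rho> s < 1 \<and> \<omega> s < e / 2"
    unfolding eventually_at_right_field by auto
  define \<sigma> where "\<sigma> = s0 / 2"
  have \<sigma>: "\<sigma> > 0" "\<rho> \<sigma> < 1" "\<omega> \<sigma> < e / 2" unfolding \<sigma>_def using s0 s0b[of "s0 / 2"] by auto
  have \<rho>0: "\<rho> \<sigma> \<ge> 0" unfolding \<rho>_def using M \<sigma> \<open>R \<ge> 0\<close> by simp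
  have time: "\<bar>approx_sol g k (b, y) - approx_sol g k (a, y)\<bar> \<le> \<omega> \<sigma>"
    if ab: "a \<le> b" "b \<le> T" "b - a + 1 / real (Suc k) \<le> \<sigma>" and y: "norm y \<le> norm x + 1" for a b k y
  proof -
    define h where "h = 1 / real (Suc k)"
    obtain m where m: "\<And>y. approx_sol g k (b, y) = (lax_step h ^^ m) (\<lambda>x. approx_sol g k (a, x)) y"
      "real m * h \<le> b - a + h"
      unfolding h_def using approx_sol_later[OF ab(1), of g k] by metis
    have h: "h > 0" unfolding h_def by simp
    have mh: "0 \<le> real m * h" "real m * h \<le> \<sigma>" using m(2) ab(3) h unfolding h_def by auto
    have re: "0 \<le> reach (real m * h) y" "reach (real m * h) y \<le> \<rho> \<sigma>"
    proof -
      show "0 \<le> reach (real m * h) y" by (rule reach_nonneg[OF mh(1)])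
      show "reach (real m * h) y \<le> \<rho> \<sigma>" unfolding reach_def \<rho>_def R_def
        using mh M y \<sigma> by (intro mult_mono) (auto simp: mult_left_mono)
    qed
    have near: "\<bar>approx_sol g k (a, y') - approx_sol g k (a, y)\<bar> \<le> C * \<rho> \<sigma>"
      if "norm (y' - y) \<le> reach (real m * h) y" for y'
    proof -
      have "norm (y' - y) \<le> \<rho> \<sigma>" using that re by linarith
      moreover have "norm y' \<le> R"
        using norm_triangle_ineq[of "y' - y" y] calculation \<sigma> y unfolding R_def by simp
      moreover have "norm y \<le> R" using y unfolding R_def by simp
      ultimately show ?thesis
        using lip[of a y' y k] ab mult_left_mono[of "norm (y' - y)" "\<rho> \<sigma>" C] C by linarith
    qed
    have Hy0: "\<bar>H y 0\<bar> \<le> M * (1 + R)"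
    proof -
      have "M * (1 + norm y) \<le> M * (1 + R)" using y M unfolding R_def by (intro mult_left_mono) auto
      then show ?thesis using growth[of y 0] by simp
    qed
    have err: "real m * h * c \<le> \<sigma> * (M * (1 + R) + M * \<rho> \<sigma>)"
      if "c \<le> M * (1 + R) + M * reach (real m * h) y" for c
    proof -
      have "M * reach (real m * h) y \<le> M * \<rho> \<sigma>" using re M by (intro mult_left_mono) auto
      then have "real m * h * c \<le> real m * h * (M * (1 + R) + M * \<rho> \<sigma>)"
        using that mh by (intro mult_left_mono) auto
      also have "\<dots> \<le> \<sigma> * (M * (1 + R) + M * \<rho> \<sigma>)"
        using mh M \<open>R \<ge> 0\<close> \<rho>0 by (intro mult_right_mono) auto
      finally show ?thesis .
    qed
    have "approx_sol g k (a, y) - C * \<rho> \<sigma> - real m * h * (H y 0 + M * (1 + norm (0::'a)) * reach (real m * h) y) \<le> approx_sol g k (b, y)"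
      unfolding m(1)
      by (rule lax_iter_ge) (use h in simp, use near in \<open>auto simp: abs_le_iff algebra_simps\<close>)
    moreover have "approx_sol g k (b, y) \<le> approx_sol g k (a, y) + C * \<rho> \<sigma> - real m * h * (H y 0 - M * (1 + norm (0::'a)) * reach (real m * h) y)"
      unfolding m(1)
      by (rule lax_iter_le) (use h in simp, use convex_approx_sol[OF g] in simp, use near in \<open>auto simp: abs_le_iff algebra_simps\<close>)
    moreover have "real m * h * (H y 0 + M * reach (real m * h) y) \<le> \<sigma> * (M * (1 + R) + M * \<rho> \<sigma>)"
      using Hy0 by (intro err) auto
    moreover have "real m * h * (- (H y 0 - M * reach (real m * h) y)) \<le> \<sigma> * (M * (1 + R) + M * \<rho> \<sigma>)"
      using Hy0 by (intro err) auto
    ultimately show ?thesis unfolding \<omega>_def by (simp add: abs_le_iff algebra_simps)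
  qed
  \<comment> \<open>The time difference and the rounding \<open>1 / real (Suc k)\<close> each take
    half of \<open>\<sigma>\<close>; the space increment takes half of \<open>e\<close>.\<close>
  define d where "d = min (min 1 (\<sigma> / 2)) (e / (2 * (C + 1)))"
  have d: "d > 0" unfolding d_def using \<sigma> e C by auto
  have dC: "C * d \<le> e / 2"
  proof -
    have "(C + 1) * d \<le> (C + 1) * (e / (2 * (C + 1)))" unfolding d_def using C by (intro mult_left_mono) auto
    also have "\<dots> = e / 2"
    proof -
      have "c * (e / (2 * c)) = e / 2" if "c > 0" for c :: real using that by simp
      then show ?thesis using C by (meson add_nonneg_pos zero_less_one)
    qed
    finally show ?thesis using d by (simp add: algebra_simps)
  qed
  have "(\<lambda>k. 1 / real (Suc k)) \<longlonglongrightarrow> 0" by (rule LIMSEQ_Suc[OF lim_1_over_n])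
  then have "\<forall>\<^sub>F k in sequentially. 1 / real (Suc k) < \<sigma> / 2"
    using \<sigma> by (intro order_tendstoD(2)) auto
  then have "\<forall>\<^sub>F k in sequentially. \<forall>z'. dist z' z < d \<longrightarrow> \<bar>approx_sol g k z' - approx_sol g k z\<bar> < e"
  proof eventually_elim
    case (elim k)
    show ?case
    proof (intro allI impI)
      fix z' assume dz: "dist z' z < d"
      obtain t' x' where z': "z' = (t', x')" by (cases z')
      have dt: "\<bar>t' - t\<bar> < d" and dx: "norm (x' - x) < d"
        using dz dist_fst_le[of z' z] dist_snd_le[of z' z] unfolding z z' by (auto simp: dist_real_def dist_norm)
      have d1: "d \<le> 1" "d \<le> \<sigma> / 2" unfolding d_def by linarith+
      have nx': "norm x' \<le> norm x + 1" using norm_triangle_ineq[of "x' - x" x] dx d1 by simp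
      have "\<bar>approx_sol g k (t', x') - approx_sol g k (t, x')\<bar> \<le> \<omega> \<sigma>"
      proof (cases "t \<le> t'")
        case True
        then show ?thesis using dt d1 elim nx' by (intro time) (auto simp: T_def)
      next
        case False
        then have "\<bar>approx_sol g k (t, x') - approx_sol g k (t', x')\<bar> \<le> \<omega> \<sigma>"
          using dt d1 elim nx' by (intro time) (auto simp: T_def)
        then show ?thesis by simp
      qed
      moreover have "\<bar>approx_sol g k (t, x') - approx_sol g k (t, x)\<bar> \<le> C * norm (x' - x)"
        using nx' by (intro lip) (auto simp: T_def R_def)
      moreover have "C * norm (x' - x) \<le> C * d" using dx C by (intro mult_left_mono) auto
      ultimately show "\<bar>approx_sol g k z' - approx_sol g k z\<bar> < e"
        unfolding z z' using \<sigma> dC by linarith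
    qed
  qed
  then show ?thesis using d by blast
qed

section \<open>The limit evolution\<close>

text \<open>The strict inequality \<open>reach s x < \<rho>\<close> absorbs the rounding: the
  discrete elapsed times tend to \<open>s\<close>, so their reach is eventually below
  \<open>\<rho>\<close>, and uniform convergence on the ball of radius \<open>\<rho>\<close>
  transfers the affine bound up to \<open>e\<close>.\<close>

lemma exists_convex_evolution:
  assumes g: "convex_on UNIV g"
  obtains u :: "real \<times> 'a \<Rightarrow> real" where "continuous_on UNIV u" "\<And>x. u (0, x) = g x"
    "\<And>t. convex_on UNIV (\<lambda>x. u (t, x))"
    "\<And>t s x p \<rho> B. 0 \<le> t \<Longrightarrow> 0 \<le> s \<Longrightarrow> reach s x < \<rho> \<Longrightarrow>
       (\<And>y. norm (y - x) \<le> \<rho> \<Longrightarrow> B \<le> u (t, y) + p \<bullet> (x - y)) \<Longrightarrow>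
       B - s * (H x p + M * (1 + norm p) * \<rho>) \<le> u (t + s, x)"
    "\<And>t s x p \<rho> B. 0 \<le> t \<Longrightarrow> 0 \<le> s \<Longrightarrow> reach s x < \<rho> \<Longrightarrow>
       (\<And>y. norm (y - x) \<le> \<rho> \<Longrightarrow> u (t, y) + p \<bullet> (x - y) \<le> B) \<Longrightarrow>
       u (t + s, x) \<le> B - s * (H x p - M * (1 + norm p) * \<rho>)"
proof -
  have "\<exists>B. \<forall>k. \<bar>approx_sol g k z\<bar> \<le> B" for z
  proof -
    obtain B where "\<And>k t x. t \<le> \<bar>fst z\<bar> \<Longrightarrow> norm x \<le> norm (snd z) \<Longrightarrow> \<bar>approx_sol g k (t, x)\<bar> \<le> B"
      using approx_sol_bounded[OF g, of "\<bar>fst z\<bar>" "norm (snd z)"] by auto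
    from this[OF abs_ge_self order_refl] show ?thesis by auto
  qed
  from asymptotically_equicontinuous_subsequence[OF this approx_sol_equicontinuous[OF g]]
  obtain r u where r: "strict_mono (r :: nat \<Rightarrow> nat)" and u: "continuous_on UNIV u"
    and unif: "\<And>K e. compact K \<Longrightarrow> 0 < e \<Longrightarrow> \<forall>\<^sub>F n in sequentially. \<forall>z\<in>K. \<bar>approx_sol g (r n) z - u z\<bar> < e"
    by blast
  have lim: "(\<lambda>n. approx_sol g (r n) z) \<longlonglongrightarrow> u z" for z
    unfolding tendsto_iff dist_real_def using unif[of "{z}"] by simp
  define h where "h = (\<lambda>n. 1 / real (Suc (r n)))"
  have h: "h n > 0" for n unfolding h_def by simp
  have h0: "h \<longlonglongrightarrow> 0"
    using LIMSEQ_subseq_LIMSEQ[OF LIMSEQ_Suc[OF lim_1_over_n] r] unfolding h_def comp_def .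
  have later: "\<exists>m. (\<forall>n x. approx_sol g (r n) (t + s, x) = (lax_step (h n) ^^ m n) (\<lambda>x. approx_sol g (r n) (t, x)) x)
      \<and> (\<lambda>n. real (m n) * h n) \<longlonglongrightarrow> s" if ts: "0 \<le> t" "0 \<le> s" for t s
  proof -
    have "\<exists>m. (\<forall>x. approx_sol g (r n) (t + s, x) = (lax_step (h n) ^^ m) (\<lambda>x. approx_sol g (r n) (t, x)) x)
       \<and> real m * h n \<le> s + h n \<and> s - h n \<le> real m * h n" for n
      using approx_sol_later[of t "t + s" g "r n"] ts unfolding h_def by (smt (verit))
    then obtain m where m: "\<And>n x. approx_sol g (r n) (t + s, x) = (lax_step (h n) ^^ m n) (\<lambda>x. approx_sol g (r n) (t, x)) x"
      and m1: "\<And>n. real (m n) * h n \<le> s + h n" and m2: "\<And>n. s - h n \<le> real (m n) * h n" by metis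
    have "(\<lambda>n. real (m n) * h n) \<longlonglongrightarrow> s"
    proof (rule tendsto_sandwich)
      show "(\<lambda>n. s - h n) \<longlonglongrightarrow> s" using tendsto_diff[OF tendsto_const h0] by simp
      show "(\<lambda>n. s + h n) \<longlonglongrightarrow> s" using tendsto_add[OF tendsto_const h0] by simp
    qed (use m1 m2 in auto)
    with m show ?thesis by blast
  qed
  have near: "\<forall>\<^sub>F n in sequentially. \<forall>y. norm (y - x) \<le> \<rho> \<longrightarrow> \<bar>approx_sol g (r n) (t, y) - u (t, y)\<bar> < e"
    if "e > 0" for t x \<rho> e
  proof -
    have "compact ({t} \<times> cball x \<rho>)" by (intro compact_Times) auto
    from unif[OF this that] show ?thesis
      by eventually_elim (auto simp: dist_norm norm_minus_commute)
  qed
  have reach_lim: "(\<lambda>n. reach (a n) x) \<longlonglongrightarrow> reach s x" if "a \<longlonglongrightarrow> s" for a s x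
    unfolding reach_def by (intro tendsto_intros that)
  show ?thesis
  proof (rule that[OF u])
    show "u (0, x) = g x" for x
      using LIMSEQ_unique[OF lim[of "(0, x)"]] by (simp add: approx_sol_def)
    show "convex_on UNIV (\<lambda>x. u (t, x))" for t
    proof (rule convex_onI)
      fix c :: real and x y :: 'a assume c: "0 < c" "c < 1"
      have "approx_sol g (r n) (t, (1 - c) *\<^sub>R x + c *\<^sub>R y)
        \<le> (1 - c) * approx_sol g (r n) (t, x) + c * approx_sol g (r n) (t, y)" for n
        using convex_onD[OF convex_approx_sol[OF g]] c by simp
      then show "u (t, (1 - c) *\<^sub>R x + c *\<^sub>R y) \<le> (1 - c) * u (t, x) + c * u (t, y)"
        by (intro LIMSEQ_le[OF lim tendsto_add[OF tendsto_mult_left[OF lim] tendsto_mult_left[OF lim]]]) blast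
    qed simp
  next
    fix t s p \<rho> B and x :: 'a
    assume ts: "0 \<le> t" "0 \<le> s" and \<rho>: "reach s x < \<rho>"
      and B: "\<And>y. norm (y - x) \<le> \<rho> \<Longrightarrow> B \<le> u (t, y) + p \<bullet> (x - y)"
    obtain m where m: "\<And>n x. approx_sol g (r n) (t + s, x) = (lax_step (h n) ^^ m n) (\<lambda>x. approx_sol g (r n) (t, x)) x"
      and mlim: "(\<lambda>n. real (m n) * h n) \<longlonglongrightarrow> s" using later[OF ts] by blast
    show "B - s * (H x p + M * (1 + norm p) * \<rho>) \<le> u (t + s, x)"
    proof (rule field_le_epsilon)
      fix e :: real assume e: "e > 0"
      have "\<forall>\<^sub>F n in sequentially. B - e - real (m n) * h n * (H x p + M * (1 + norm p) * \<rho>) \<le> approx_sol g (r n) (t + s, x)"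
        using near[OF e, of x \<rho> t] order_tendstoD(2)[OF reach_lim[OF mlim] \<rho>]
      proof eventually_elim
        case (elim n)
        have mh: "real (m n) * h n \<ge> 0" using h[of n] by simp
        have "B - e - real (m n) * h n * (H x p + M * (1 + norm p) * reach (real (m n) * h n) x) \<le> approx_sol g (r n) (t + s, x)"
          unfolding m
        proof (rule lax_iter_ge)
          fix y assume "norm (y - x) \<le> reach (real (m n) * h n) x"
          then have "norm (y - x) \<le> \<rho>" using elim by simp
          then show "B - e \<le> approx_sol g (r n) (t, y) + p \<bullet> (x - y)"
            using B[of y] elim by (smt (verit))
        qed (use h[of n] in simp)
        moreover have "real (m n) * h n * (H x p + M * (1 + norm p) * reach (real (m n) * h n) x)
            \<le> real (m n) * h n * (H x p + M * (1 + norm p) * \<rho>)"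
          using mh M elim by (intro mult_left_mono add_left_mono) auto
        ultimately show ?case by linarith
      qed
      moreover have "(\<lambda>n. B - e - real (m n) * h n * (H x p + M * (1 + norm p) * \<rho>))
          \<longlonglongrightarrow> B - e - s * (H x p + M * (1 + norm p) * \<rho>)"
        by (intro tendsto_intros mlim)
      ultimately have "B - e - s * (H x p + M * (1 + norm p) * \<rho>) \<le> u (t + s, x)"
        by (intro tendsto_le[OF _ lim]) auto
      then show "B - s * (H x p + M * (1 + norm p) * \<rho>) \<le> u (t + s, x) + e" by simp
    qed
  next
    fix t s p \<rho> B and x :: 'a
    assume ts: "0 \<le> t" "0 \<le> s" and \<rho>: "reach s x < \<rho>"
      and B: "\<And>y. norm (y - x) \<le> \<rho> \<Longrightarrow> u (t, y) + p \<bullet> (x - y) \<le> B"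
    obtain m where m: "\<And>n x. approx_sol g (r n) (t + s, x) = (lax_step (h n) ^^ m n) (\<lambda>x. approx_sol g (r n) (t, x)) x"
      and mlim: "(\<lambda>n. real (m n) * h n) \<longlonglongrightarrow> s" using later[OF ts] by blast
    show "u (t + s, x) \<le> B - s * (H x p - M * (1 + norm p) * \<rho>)"
    proof (rule field_le_epsilon)
      fix e :: real assume e: "e > 0"
      have "\<forall>\<^sub>F n in sequentially. approx_sol g (r n) (t + s, x) \<le> B + e - real (m n) * h n * (H x p - M * (1 + norm p) * \<rho>)"
        using near[OF e, of x \<rho> t] order_tendstoD(2)[OF reach_lim[OF mlim] \<rho>]
      proof eventually_elim
        case (elim n)
        have mh: "real (m n) * h n \<ge> 0" using h[of n] by simp
        have "approx_sol g (r n) (t + s, x) \<le> B + e - real (m n) * h n * (H x p - M * (1 + norm p) * reach (real (m n) * h n) x)"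
          unfolding m
        proof (rule lax_iter_le)
          fix y assume "norm (y - x) \<le> reach (real (m n) * h n) x"
          then have "norm (y - x) \<le> \<rho>" using elim by simp
          then show "approx_sol g (r n) (t, y) + p \<bullet> (x - y) \<le> B + e"
            using B[of y] elim by (smt (verit))
        qed (use h[of n] convex_approx_sol[OF g] in simp_all)
        moreover have "real (m n) * h n * (H x p - M * (1 + norm p) * \<rho>)
            \<le> real (m n) * h n * (H x p - M * (1 + norm p) * reach (real (m n) * h n) x)"
          using mh M elim by (intro mult_left_mono diff_left_mono) auto
        ultimately show ?case by linarith
      qed
      moreover have "(\<lambda>n. B + e - real (m n) * h n * (H x p - M * (1 + norm p) * \<rho>))
          \<longlonglongrightarrow> B + e - s * (H x p - M * (1 + norm p) * \<rho>)"
        by (intro tendsto_intros mlim)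
      ultimately have "u (t + s, x) \<le> B + e - s * (H x p - M * (1 + norm p) * \<rho>)"
        by (intro tendsto_le[OF _ _ lim]) auto
      then show "u (t + s, x) \<le> B - s * (H x p - M * (1 + norm p) * \<rho>) + e" by simp
    qed
  qed
qed

end

section \<open>Bilateral solutions\<close>

text \<open>Near \<open>x\<close> the function lies between an affine minorant of slope
  \<open>v\<close> and the first-order upper bound of slope \<open>p\<close>; moving in the
  direction \<open>v - p\<close> forces the two slopes to agree.\<close>

lemma convex_supergradient_is_subgradient:
  fixes f :: "'a::euclidean_space \<Rightarrow> real"
  assumes "convex_on UNIV f"
    and super: "\<And>\<epsilon>. \<epsilon> > 0 \<Longrightarrow> \<exists>\<delta>>0. \<forall>y. norm (y - x) < \<delta> \<longrightarrow> f y \<le> f x + p \<bullet> (y - x) + \<epsilon> * norm (y - x)"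
  shows "f x + p \<bullet> (y - x) \<le> f y"
proof -
  obtain v where v: "\<And>y. f x + v \<bullet> (y - x) \<le> f y"
    using convex_subgradient_exists[OF assms(1)] by blast
  have "norm (v - p) \<le> 0 + \<epsilon>" if eps: "\<epsilon> > 0" for \<epsilon>
  proof -
    obtain \<delta> where \<delta>: "\<delta> > 0" "\<And>y. norm (y - x) < \<delta> \<Longrightarrow> f y \<le> f x + p \<bullet> (y - x) + \<epsilon> * norm (y - x)"
      using super[OF eps] by blast
    define c where "c = \<delta> / (2 * (norm (v - p) + 1))"
    have c: "c > 0" unfolding c_def using \<delta> by (intro divide_pos_pos mult_pos_pos add_nonneg_pos) auto
    have "c * (norm (v - p) + 1) = \<delta> / 2"
    proof -
      have "\<delta> / (2 * b) * b = \<delta> / 2" if "b > 0" for b :: real using that by simp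
      then show ?thesis unfolding c_def by (meson add_nonneg_pos norm_ge_zero zero_less_one)
    qed
    then have small: "c * norm (v - p) < \<delta>" using c \<delta>(1) unfolding distrib_left by linarith
    define y where "y = x + c *\<^sub>R (v - p)"
    have "norm (y - x) = c * norm (v - p)" unfolding y_def using c by simp
    then have "(v - p) \<bullet> (y - x) \<le> \<epsilon> * (c * norm (v - p))"
      using v[of y] \<delta>(2)[of y] small by (simp add: inner_diff_left)
    then have "c * (norm (v - p) * norm (v - p)) \<le> c * (\<epsilon> * norm (v - p))"
      unfolding y_def by (simp add: power2_norm_eq_inner[symmetric] power2_eq_square mult.left_commute)
    then have "norm (v - p) * norm (v - p) \<le> \<epsilon> * norm (v - p)" using c by simp
    then show ?thesis using that by (cases "v = p") auto
  qed
  then have "norm (v - p) \<le> 0" by (rule field_le_epsilon)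
  then show ?thesis using v by simp
qed

context convex_concave_hamiltonian
begin

section \<open>Existence of a bilateral solution\<close>

lemma exists_bilateral_solution:
  assumes g: "convex_on UNIV g"
  obtains u :: "real \<times> 'a \<Rightarrow> real" where "continuous_on UNIV u" "\<And>x. u (0, x) = g x"
    "\<And>z d. z \<in> {0<..} \<times> UNIV \<Longrightarrow> d \<in> superdiff u z \<Longrightarrow> fst d + H (snd z) (snd d) = 0"
    "\<And>z d. z \<in> {0<..} \<times> UNIV \<Longrightarrow> d \<in> subdiff u z \<Longrightarrow> fst d + H (snd z) (snd d) = 0"
proof (rule exists_convex_evolution[OF g])
  fix u :: "real \<times> 'a \<Rightarrow> real"
  assume u: "continuous_on UNIV u" and u0: "\<And>x. u (0, x) = g x"
    and conv: "\<And>t. convex_on UNIV (\<lambda>x. u (t, x))"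
    and lower: "\<And>t s x p \<rho> B. 0 \<le> t \<Longrightarrow> 0 \<le> s \<Longrightarrow> reach s x < \<rho> \<Longrightarrow>
       (\<And>y. norm (y - x) \<le> \<rho> \<Longrightarrow> B \<le> u (t, y) + p \<bullet> (x - y)) \<Longrightarrow>
       B - s * (H x p + M * (1 + norm p) * \<rho>) \<le> u (t + s, x)"
    and upper: "\<And>t s x p \<rho> B. 0 \<le> t \<Longrightarrow> 0 \<le> s \<Longrightarrow> reach s x < \<rho> \<Longrightarrow>
       (\<And>y. norm (y - x) \<le> \<rho> \<Longrightarrow> u (t, y) + p \<bullet> (x - y) \<le> B) \<Longrightarrow>
       u (t + s, x) \<le> B - s * (H x p - M * (1 + norm p) * \<rho>)"
  \<comment> \<open>For \<open>M * s \<le> 1\<close> one has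
    \<open>exp (M * s) - 1 \<le> 2 * (M * s)\<close>; the added 1 makes the bound on
    \<open>reach\<close> strict.\<close>
  define K where "K = (\<lambda>x::'a. 2 * M * (1 + norm x) + 1)"
  have K1: "K x \<ge> 1" for x unfolding K_def using M by simp
  have reachK: "reach s x < K x * s" if s: "s > 0" "M * s \<le> 1" for s x
  proof -
    have "exp (M * s) \<le> 1 + M * s + (M * s)\<^sup>2" using exp_bound[of "M * s"] s M by simp
    also have "(M * s)\<^sup>2 \<le> M * s" using s M by (simp add: power2_eq_square mult_left_le)
    finally have "(exp (M * s) - 1) * (1 + norm x) \<le> (2 * (M * s)) * (1 + norm x)"
      by (intro mult_right_mono) auto
    then show ?thesis unfolding reach_def K_def using s by (simp add: algebra_simps)
  qed
  \<comment> \<open>Common end of the next three estimates: after division by \<open>s\<close>,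
    first \<open>s\<close> tends to 0 and then the first-order error.\<close>
  have limit: "a \<le> 0" if ev: "\<And>\<epsilon>. \<epsilon> > 0 \<Longrightarrow> \<exists>s0>0. \<forall>s. 0 < s \<longrightarrow> s < s0 \<longrightarrow> a \<le> \<epsilon> * (1 + b) + c * s"
    and b: "b \<ge> 0" for a b c :: real
  proof (rule field_le_epsilon)
    fix e :: real assume "e > 0"
    define \<epsilon> where "\<epsilon> = e / (1 + b)"
    have \<epsilon>: "\<epsilon> > 0" unfolding \<epsilon>_def using \<open>e > 0\<close> b by (intro divide_pos_pos) auto
    have \<epsilon>e: "\<epsilon> * (1 + b) = e" unfolding \<epsilon>_def using b by simp
    obtain s0 where s0: "s0 > 0" "\<And>s. 0 < s \<Longrightarrow> s < s0 \<Longrightarrow> a \<le> \<epsilon> * (1 + b) + c * s" using ev[OF \<epsilon>] by blast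
    have "a \<le> e + c * 0"
    proof (rule tendsto_lowerbound)
      show "((\<lambda>s. e + c * s) \<longlongrightarrow> e + c * 0) (at_right 0)" by (intro tendsto_intros)
      show "\<forall>\<^sub>F s in at_right 0. a \<le> e + c * s"
        unfolding eventually_at_right_field using s0 \<epsilon>e by auto
    qed simp
    then show "a \<le> 0 + e" by simp
  qed
  have bound_in: "dist (t + \<tau>, y) (t, x) < \<delta>" "norm ((t + \<tau>, y) - (t, x)) \<le> s * (1 + K x)"
    if "\<bar>\<tau>\<bar> \<le> s" "norm (y - x) \<le> K x * s" "s * (1 + K x) < \<delta>" for t \<tau> s y \<delta> and x :: 'a
  proof -
    have "norm ((t + \<tau>, y) - (t, x)) \<le> \<bar>\<tau>\<bar> + norm (y - x)"
      using norm_Pair_le[of \<tau> "y - x"] by simp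
    also have "\<dots> \<le> s * (1 + K x)" using that by (simp add: algebra_simps)
    finally show "norm ((t + \<tau>, y) - (t, x)) \<le> s * (1 + K x)" .
    then show "dist (t + \<tau>, y) (t, x) < \<delta>" using that unfolding dist_norm by linarith
  qed
  have small: "\<exists>s0>0. \<forall>s. 0 < s \<longrightarrow> s < s0 \<longrightarrow> s < t \<and> M * s \<le> 1 \<and> s * (1 + K x) < \<delta>"
    if "t > 0" "\<delta> > 0" for t \<delta> x
  proof -
    define s0 where "s0 = min t (min (1 / (M + 1)) (\<delta> / (1 + K x)))"
    have "s0 > 0" unfolding s0_def using that M K1[of x] by auto
    moreover have "s < t \<and> M * s \<le> 1 \<and> s * (1 + K x) < \<delta>" if s: "0 < s" "s < s0" for s
    proof -
      have "s < t" "s < 1 / (M + 1)" "s < \<delta> / (1 + K x)" using s unfolding s0_def by auto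
      moreover have "s * (M + 1) < 1" using calculation(2) M by (simp add: pos_less_divide_eq)
      moreover have "s * (1 + K x) < \<delta>" using calculation(3) K1[of x] by (simp add: pos_less_divide_eq)
      ultimately show ?thesis using s by (simp add: algebra_simps)
    qed
    ultimately show ?thesis by blast
  qed
  \<comment> \<open>The superdifferential bounds \<open>u\<close> at time \<open>t - s\<close> from
    above by an affine function of slope \<open>p\<close>. Carrying it forward with
    \<open>upper\<close> must reproduce at least \<open>u (t, x)\<close>.\<close>
  have sup_le: "q + H x p \<le> 0" if t: "t > 0" and d: "(q, p) \<in> superdiff u (t, x)" for t x q p
  proof (rule limit)
    show "K x \<ge> 0" using K1[of x] by simp
    fix \<epsilon> :: real assume "\<epsilon> > 0"
    from superdiffD[OF d this] obtain \<delta> where \<delta>: "\<delta> > 0"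
      "\<And>y. dist y (t, x) < \<delta> \<Longrightarrow> u y \<le> u (t, x) + (q, p) \<bullet> (y - (t, x)) + \<epsilon> * norm (y - (t, x))" by blast
    from small[OF t \<delta>(1), of x] obtain s0 where s0: "s0 > 0"
      "\<And>s. 0 < s \<Longrightarrow> s < s0 \<Longrightarrow> s < t \<and> M * s \<le> 1 \<and> s * (1 + K x) < \<delta>" by blast
    have "q + H x p \<le> \<epsilon> * (1 + K x) + (M * (1 + norm p) * K x) * s" if s: "0 < s" "s < s0" for s
    proof -
      have s': "s < t" "M * s \<le> 1" "s * (1 + K x) < \<delta>" using s0(2)[OF s] by auto
      have "u (t - s + s, x) \<le> u (t, x) - q * s + \<epsilon> * (s * (1 + K x)) - s * (H x p - M * (1 + norm p) * (K x * s))"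
      proof (rule upper[OF _ _ reachK])
        fix y assume y: "norm (y - x) \<le> K x * s"
        note b = bound_in[of "- s" s y x \<delta> t, OF _ y s'(3)]
        have "u (t + - s, y) \<le> u (t, x) + (q, p) \<bullet> ((t + - s, y) - (t, x)) + \<epsilon> * norm ((t + - s, y) - (t, x))"
          using b s by (intro \<delta>(2)) auto
        moreover have "\<epsilon> * norm ((t + - s, y) - (t, x)) \<le> \<epsilon> * (s * (1 + K x))"
          using b s \<open>\<epsilon> > 0\<close> by (intro mult_left_mono) auto
        ultimately show "u (t - s, y) + p \<bullet> (x - y) \<le> u (t, x) - q * s + \<epsilon> * (s * (1 + K x))"
          by (simp add: inner_diff_right)
      qed (use s s' in auto)
      then have "s * (q + H x p) \<le> s * (\<epsilon> * (1 + K x) + (M * (1 + norm p) * K x) * s)"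
        by (simp add: algebra_simps)
      then show ?thesis using s by simp
    qed
    then show "\<exists>s0>0. \<forall>s. 0 < s \<longrightarrow> s < s0 \<longrightarrow> q + H x p \<le> \<epsilon> * (1 + K x) + (M * (1 + norm p) * K x) * s"
      using s0(1) by blast
  qed
  \<comment> \<open>Mirror image of \<open>sup_le\<close>, with \<open>lower\<close>.\<close>
  have sub_ge: "- (q + H x p) \<le> 0" if t: "t > 0" and d: "(q, p) \<in> subdiff u (t, x)" for t x q p
  proof (rule limit)
    show "K x \<ge> 0" using K1[of x] by simp
    fix \<epsilon> :: real assume "\<epsilon> > 0"
    from subdiffD[OF d this] obtain \<delta> where \<delta>: "\<delta> > 0"
      "\<And>y. dist y (t, x) < \<delta> \<Longrightarrow> u y \<ge> u (t, x) + (q, p) \<bullet> (y - (t, x)) - \<epsilon> * norm (y - (t, x))" by blast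
    from small[OF t \<delta>(1), of x] obtain s0 where s0: "s0 > 0"
      "\<And>s. 0 < s \<Longrightarrow> s < s0 \<Longrightarrow> s < t \<and> M * s \<le> 1 \<and> s * (1 + K x) < \<delta>" by blast
    have "- (q + H x p) \<le> \<epsilon> * (1 + K x) + (M * (1 + norm p) * K x) * s" if s: "0 < s" "s < s0" for s
    proof -
      have s': "s < t" "M * s \<le> 1" "s * (1 + K x) < \<delta>" using s0(2)[OF s] by auto
      have "u (t, x) - q * s - \<epsilon> * (s * (1 + K x)) - s * (H x p + M * (1 + norm p) * (K x * s)) \<le> u (t - s + s, x)"
      proof (rule lower[OF _ _ reachK])
        fix y assume y: "norm (y - x) \<le> K x * s"
        note b = bound_in[of "- s" s y x \<delta> t, OF _ y s'(3)]
        have "u (t + - s, y) \<ge> u (t, x) + (q, p) \<bullet> ((t + - s, y) - (t, x)) - \<epsilon> * norm ((t + - s, y) - (t, x))"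
          using b s by (intro \<delta>(2)) auto
        moreover have "\<epsilon> * norm ((t + - s, y) - (t, x)) \<le> \<epsilon> * (s * (1 + K x))"
          using b s \<open>\<epsilon> > 0\<close> by (intro mult_left_mono) auto
        ultimately show "u (t, x) - q * s - \<epsilon> * (s * (1 + K x)) \<le> u (t - s, y) + p \<bullet> (x - y)"
          by (simp add: inner_diff_right)
      qed (use s s' in auto)
      then have "s * - (q + H x p) \<le> s * (\<epsilon> * (1 + K x) + (M * (1 + norm p) * K x) * s)"
        by (simp add: algebra_simps)
      then show ?thesis using s by (simp only: mult_le_cancel_left_pos)
    qed
    then show "\<exists>s0>0. \<forall>s. 0 < s \<longrightarrow> s < s0 \<longrightarrow> - (q + H x p) \<le> \<epsilon> * (1 + K x) + (M * (1 + norm p) * K x) * s"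
      using s0(1) by blast
  qed
  \<comment> \<open>Here the evolution starts at time \<open>t\<close>. The global subgradient
    \<open>p\<close> makes the bound fed to \<open>lower\<close> exact, and the superdifferential
    limits the growth of \<open>u\<close> in time at the fixed point \<open>x\<close>.\<close>
  have sup_ge: "- (q + H x p) \<le> 0" if t: "t > 0" and d: "(q, p) \<in> superdiff u (t, x)" for t x q p
  proof (rule limit)
    show "K x \<ge> 0" using K1[of x] by simp
    have grad: "u (t, x) + p \<bullet> (y - x) \<le> u (t, y)" for y
    proof (rule convex_supergradient_is_subgradient[OF conv])
      fix \<epsilon> :: real assume "\<epsilon> > 0"
      from superdiffD[OF d this] obtain \<delta> where \<delta>: "\<delta> > 0"
        "\<And>y. dist y (t, x) < \<delta> \<Longrightarrow> u y \<le> u (t, x) + (q, p) \<bullet> (y - (t, x)) + \<epsilon> * norm (y - (t, x))" by blast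
      have "u (t, y) \<le> u (t, x) + p \<bullet> (y - x) + \<epsilon> * norm (y - x)" if "norm (y - x) < \<delta>" for y
        using \<delta>(2)[of "(t, y)"] that by (simp add: dist_Pair_Pair dist_norm)
      with \<delta>(1) show "\<exists>\<delta>>0. \<forall>y. norm (y - x) < \<delta> \<longrightarrow> u (t, y) \<le> u (t, x) + p \<bullet> (y - x) + \<epsilon> * norm (y - x)" by blast
    qed
    fix \<epsilon> :: real assume "\<epsilon> > 0"
    from superdiffD[OF d this] obtain \<delta> where \<delta>: "\<delta> > 0"
      "\<And>y. dist y (t, x) < \<delta> \<Longrightarrow> u y \<le> u (t, x) + (q, p) \<bullet> (y - (t, x)) + \<epsilon> * norm (y - (t, x))" by blast
    from small[OF t \<delta>(1), of x] obtain s0 where s0: "s0 > 0"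
      "\<And>s. 0 < s \<Longrightarrow> s < s0 \<Longrightarrow> s < t \<and> M * s \<le> 1 \<and> s * (1 + K x) < \<delta>" by blast
    have "- (q + H x p) \<le> \<epsilon> * (1 + K x) + (M * (1 + norm p) * K x) * s" if s: "0 < s" "s < s0" for s
    proof -
      have s': "s < t" "M * s \<le> 1" "s * (1 + K x) < \<delta>" using s0(2)[OF s] by auto
      have Ks: "K x * s \<ge> 0" using K1[of x] s by simp
      have "u (t, x) - s * (H x p + M * (1 + norm p) * (K x * s)) \<le> u (t + s, x)"
      proof (rule lower[OF _ _ reachK])
        show "u (t, x) \<le> u (t, y) + p \<bullet> (x - y)" for y
          using grad[of y] by (simp add: inner_diff_right)
      qed (use s s' t in auto)
      moreover have "u (t + s, x) \<le> u (t, x) + q * s + \<epsilon> * (s * (1 + K x))"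
      proof -
        note b = bound_in[of s s x x \<delta> t, OF _ _ s'(3)]
        have "u (t + s, x) \<le> u (t, x) + (q, p) \<bullet> ((t + s, x) - (t, x)) + \<epsilon> * norm ((t + s, x) - (t, x))"
          using b s Ks by (intro \<delta>(2)) auto
        moreover have "\<epsilon> * norm ((t + s, x) - (t, x)) \<le> \<epsilon> * (s * (1 + K x))"
          using b s Ks \<open>\<epsilon> > 0\<close> by (intro mult_left_mono) auto
        ultimately show ?thesis by simp
      qed
      ultimately have "s * - (q + H x p) \<le> s * (\<epsilon> * (1 + K x) + (M * (1 + norm p) * K x) * s)"
        by (simp add: algebra_simps)
      then show ?thesis using s by (simp only: mult_le_cancel_left_pos)
    qed
    then show "\<exists>s0>0. \<forall>s. 0 < s \<longrightarrow> s < s0 \<longrightarrow> - (q + H x p) \<le> \<epsilon> * (1 + K x) + (M * (1 + norm p) * K x) * s"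
      using s0(1) by blast
  qed
  \<comment> \<open>The local Lipschitz bound at time \<open>t\<close> required by
    \<open>subdiff_of_subsolution\<close> comes from convexity of \<open>u\<close> in space.\<close>
  have sub_le: "fst d + H x (snd d) \<le> 0" if t: "t > 0" and d: "d \<in> subdiff u (t, x)" for t x d
  proof -
    have "continuous_on UNIV (\<lambda>y. u (t, y))" using conv[of t] by (simp add: convex_on_continuous)
    then have "compact ((\<lambda>y. u (t, y)) ` cball 0 (norm x + 2))"
      by (intro compact_continuous_image) (auto intro: continuous_on_subset)
    then have "bounded ((\<lambda>y. u (t, y)) ` cball 0 (norm x + 2))" by (rule compact_imp_bounded)
    then obtain B where "\<forall>b\<in>(\<lambda>y. u (t, y)) ` cball 0 (norm x + 2). norm b \<le> B" unfolding bounded_iff by blast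
    then have B: "\<bar>u (t, y)\<bar> \<le> B" if "norm y \<le> (norm x + 1) + 1" for y using that by simp
    have B0: "B \<ge> 0" using B[of x] by simp
    show ?thesis
    proof (rule subdiff_of_subsolution[OF M convH H_Lipschitz_space _ _ t _ _ _ d])
      show "continuous_on ({0<..} \<times> UNIV) u" using u continuous_on_subset by blast
      show "fst g + H (snd z) (snd g) \<le> 0" if "z \<in> {0<..} \<times> UNIV" "g \<in> superdiff u z" for z g
        using sup_le[of "fst z" "fst g" "snd g" "snd z"] that by (cases z, cases g) auto
      show "(1::real) > 0" by simp
      show "2 * B \<ge> 0" using B0 by simp
      fix y assume "norm (y - x) \<le> 1"
      then have "norm y \<le> norm x + 1" using norm_triangle_ineq[of "y - x" x] by simp
      then have "\<bar>u (t, y) - u (t, x)\<bar> \<le> 2 * B * norm (y - x)"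
        by (intro convex_bounded_Lipschitz[OF conv B]) auto
      then show "u (t, y) \<le> u (t, x) + 2 * B * norm (y - x)" by linarith
    qed
  qed
  show ?thesis
  proof (rule that[OF u u0])
    fix z d :: "real \<times> 'a" assume z: "z \<in> {0<..} \<times> UNIV"
    obtain t x where tx: "z = (t, x)" by (cases z)
    obtain q p where qp: "d = (q, p)" by (cases d)
    have t: "t > 0" using z tx by simp
    show "fst d + H (snd z) (snd d) = 0" if "d \<in> superdiff u z"
      using sup_le[OF t] sup_ge[OF t] that unfolding tx qp by fastforce
    show "fst d + H (snd z) (snd d) = 0" if "d \<in> subdiff u z"
      using sub_le[OF t] sub_ge[OF t] that unfolding tx qp by fastforce
  qed
qed

section \<open>Uniqueness of forward solutions\<close>

text \<open>Comparison in both directions covers the times before \<open>T\<close>; the final time,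
  which is not interior, follows by continuity.\<close>

lemma forward_visc_unique:
  assumes v: "fwd_T H T v" and w: "fwd_T H T w" and init: "v 0 = w 0" and t: "t \<in> {0..T}" and T: "T > 0"
  shows "v t = w t"
proof -
  have le: "v t x \<le> w t x" if v: "fwd_T H T v" and w: "fwd_T H T w" and init: "v 0 = w 0"
    for v w and x :: 'a
  proof -
    have cv: "continuous_on ({0..T} \<times> UNIV) (\<lambda>z. v (fst z) (snd z))"
      and cw: "continuous_on ({0..T} \<times> UNIV) (\<lambda>z. w (fst z) (snd z))"
      using v w unfolding forward_visc_def by auto
    have before: "v s x \<le> w s x" if s: "0 \<le> s" "s < T" for s
    proof -
      have "(\<lambda>z. v (fst z) (snd z)) (s, x) \<le> (\<lambda>z. w (fst z) (snd z)) (s, x)"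
      proof (rule comparison_principle[OF M H_Lipschitz_momentum H_Lipschitz_space cv cw _ _ _ s])
        show "fst g + H (snd z) (snd g) \<le> 0"
          if "z \<in> {0<..<T} \<times> UNIV" "g \<in> superdiff (\<lambda>z. v (fst z) (snd z)) z" for z g
          using v that unfolding forward_visc_def by blast
        show "fst g + H (snd z) (snd g) \<ge> 0"
          if "z \<in> {0<..<T} \<times> UNIV" "g \<in> subdiff (\<lambda>z. w (fst z) (snd z)) z" for z g
          using w that unfolding forward_visc_def by blast
      qed (use init in simp)
      then show ?thesis by simp
    qed
    have cont: "continuous_on {0..T} (\<lambda>s. w s x - v s x)"
    proof -
      have "continuous_on {0..T} (\<lambda>s. (\<lambda>z. w (fst z) (snd z)) (s, x))"
        by (rule continuous_on_compose2[OF cw]) (auto intro!: continuous_intros)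
      moreover have "continuous_on {0..T} (\<lambda>s. (\<lambda>z. v (fst z) (snd z)) (s, x))"
        by (rule continuous_on_compose2[OF cv]) (auto intro!: continuous_intros)
      ultimately show ?thesis by (auto intro!: continuous_intros)
    qed
    have "w t x - v t x \<ge> 0"
    proof (rule continuous_ge_on_closure[of "{0..<T}" "\<lambda>s. w s x - v s x" t 0])
      show "continuous_on (closure {0..<T}) (\<lambda>s. w s x - v s x)" using cont T by simp
      show "t \<in> closure {0..<T}" using t T by simp
      show "\<And>s. s \<in> {0..<T} \<Longrightarrow> 0 \<le> w s x - v s x" using before by simp
    qed
    then show ?thesis by simp
  qed
  show ?thesis using le[OF v w init] le[OF w v init[symmetric]] by (intro ext antisym) auto
qed

end

section \<open>Time reversal\<close>

text \<open>The time component is negated twice, by the reflection and by the sign of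
  \<open>U\<close>, whereas the space component is negated once.\<close>

lemma superdiff_time_reversal:
  fixes U :: "real \<times> 'a::euclidean_space \<Rightarrow> real"
  assumes "(q, p) \<in> superdiff (\<lambda>z. - U (T - fst z, snd z)) (t, x)"
  shows "(q, - p) \<in> subdiff U (T - t, x)"
proof -
  let ?R = "\<lambda>z::real \<times> 'a. (T - fst z, snd z)"
  obtain \<phi> G e where qp: "(q, p) = G (t, x)" and C: "C1_with_grad \<phi> G" and e: "e > 0"
    and mx: "\<And>y. y \<in> ball (t, x) e \<Longrightarrow> - U (?R y) - \<phi> y \<le> - U (?R (t, x)) - \<phi> (t, x)"
    using assms unfolding superdiff_def mem_Collect_eq fst_conv snd_conv by blast
  have contG: "continuous_on UNIV G" and der: "\<And>z. (\<phi> has_derivative (\<lambda>h. G z \<bullet> h)) (at z)"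
    using C unfolding C1_with_grad_def by auto
  have RR: "?R (?R z) = z" for z by simp
  define G' where "G' = (\<lambda>z. (fst (G (?R z)), - snd (G (?R z))))"
  have C': "C1_with_grad (\<lambda>z. - \<phi> (?R z)) G'"
    unfolding C1_with_grad_def
  proof (intro conjI allI)
    have "continuous_on UNIV (\<lambda>z. G (?R z))"
      by (rule continuous_on_compose2[OF contG]) (auto intro!: continuous_intros)
    then show "continuous_on UNIV G'" unfolding G'_def by (intro continuous_intros)
    fix z
    have "(?R has_derivative (\<lambda>h. (- fst h, snd h))) (at z)"
      by (auto intro!: derivative_eq_intros)
    from has_derivative_minus[OF has_derivative_compose[OF this der]]
    show "((\<lambda>z. - \<phi> (?R z)) has_derivative (\<lambda>h. G' z \<bullet> h)) (at z)"
      by (rule has_derivative_eq_rhs) (simp add: G'_def inner_prod_def fun_eq_iff)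
  qed
  have mn: "U y - - \<phi> (?R y) \<ge> U (T - t, x) - - \<phi> (?R (T - t, x))" if "y \<in> ball (T - t, x) e" for y
  proof -
    have "dist (t, x) (?R y) = dist (T - t, x) y"
      by (cases y) (simp add: dist_Pair_Pair dist_real_def abs_minus_commute algebra_simps)
    then show ?thesis using mx[of "?R y"] that by (simp add: RR)
  qed
  have "G' (T - t, x) \<in> subdiff U (T - t, x)"
    by (rule subdiffI[OF C' open_ball _ mn]) (use e in auto)
  moreover have "G' (T - t, x) = (q, - p)" unfolding G'_def by (simp flip: qp)
  ultimately show ?thesis by simp
qed

lemma subdiff_time_reversal:
  fixes U :: "real \<times> 'a::euclidean_space \<Rightarrow> real"
  assumes "(q, p) \<in> subdiff (\<lambda>z. - U (T - fst z, snd z)) (t, x)"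
  shows "(q, - p) \<in> superdiff U (T - t, x)"
proof -
  have "(- q, - p) \<in> superdiff (\<lambda>z. - (\<lambda>z. - U z) (T - fst z, snd z)) (t, x)"
    using assms unfolding subdiff_iff_superdiff by simp
  from superdiff_time_reversal[OF this] show ?thesis
    unfolding subdiff_iff_superdiff by simp
qed

text \<open>The negation exchanges sub- and superdifferentials, and this matches the backward
  inequalities with the forward ones.\<close>

lemma forward_visc_time_reversal:
  fixes w :: "real \<Rightarrow> 'a::euclidean_space \<Rightarrow> real"
  assumes "bwd_T H T w"
  shows "fwd_T (\<lambda>x p. H x (- p)) T (\<lambda>t x. - w (T - t) x)"
proof -
  let ?W = "\<lambda>z. w (fst z) (snd z)"
  have cont: "continuous_on ({0..T} \<times> UNIV) ?W"
    and sup: "\<And>z g. z \<in> {0<..<T} \<times> UNIV \<Longrightarrow> g \<in> superdiff ?W z \<Longrightarrow> fst g + H (snd z) (snd g) \<ge> 0"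
    and sub: "\<And>z g. z \<in> {0<..<T} \<times> UNIV \<Longrightarrow> g \<in> subdiff ?W z \<Longrightarrow> fst g + H (snd z) (snd g) \<le> 0"
    using assms unfolding backward_visc_def by blast+
  have eq: "(\<lambda>z. - w (T - fst z) (snd z)) = (\<lambda>z. - ?W (T - fst z, snd z))" by simp
  show ?thesis unfolding forward_visc_def eq
  proof (intro conjI ballI)
    show "continuous_on ({0..T} \<times> UNIV) (\<lambda>z. - ?W (T - fst z, snd z))"
      by (intro continuous_intros continuous_on_compose2[OF cont]) auto
  next
    fix z g :: "real \<times> 'a" assume z: "z \<in> {0<..<T} \<times> UNIV"
    obtain t x where tx: "z = (t, x)" by (cases z)
    obtain q p where qp: "g = (q, p)" by (cases g)
    have in_T: "(T - t, x) \<in> {0<..<T} \<times> UNIV" using z tx by auto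
    show "fst g + H (snd z) (- snd g) \<le> 0" if "g \<in> superdiff (\<lambda>z. - ?W (T - fst z, snd z)) z"
      using sub[OF in_T superdiff_time_reversal[OF that[unfolded tx qp]]] by (simp add: tx qp)
    show "fst g + H (snd z) (- snd g) \<ge> 0" if "g \<in> subdiff (\<lambda>z. - ?W (T - fst z, snd z)) z"
      using sup[OF in_T subdiff_time_reversal[OF that[unfolded tx qp]]] by (simp add: tx qp)
  qed
qed

lemma (in convex_concave_hamiltonian) backward_visc_unique:
  assumes v: "bwd_T H T v" and w: "bwd_T H T w" and final: "v T = w T" and t: "t \<in> {0..T}" and T: "T > 0"
  shows "v t = w t"
proof -
  interpret reflected: convex_concave_hamiltonian "\<lambda>x p. H x (- p)" M
  proof
    show "convex_on UNIV (\<lambda>p. H x (- p))" for x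
    proof (rule convex_onI)
      fix c :: real and p q :: 'a assume "0 < c" "c < 1"
      then show "H x (- ((1 - c) *\<^sub>R p + c *\<^sub>R q)) \<le> (1 - c) * H x (- p) + c * H x (- q)"
        using convex_onD[OF convH[of x], of c "- p" "- q"] by simp
    qed simp
    show "concave_on UNIV (\<lambda>x. H x (- p))" for p by (rule concH)
    show "\<bar>H x (- p)\<bar> \<le> M * (1 + norm x) * (1 + norm p)" for x p using growth[of x "- p"] by simp
  qed (rule M)
  have "(\<lambda>t x. - v (T - t) x) (T - t) = (\<lambda>t x. - w (T - t) x) (T - t)"
    by (rule reflected.forward_visc_unique[OF forward_visc_time_reversal[OF v] forward_visc_time_reversal[OF w]])
       (use final t T in auto)
  then show ?thesis by (simp add: fun_eq_iff)
qed

theorem theorem5p8: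
  fixes H :: "real^'n \<Rightarrow> real^'n \<Rightarrow> real" and g0 :: "real^'n \<Rightarrow> real" and M :: real
  assumes convH: "\<And>x. convex_on UNIV (\<lambda>p. H x p)"
    and concH: "\<And>p. concave_on UNIV (\<lambda>x. H x p)"
    and M: "M \<ge> 0"
    and growth: "\<And>x p. \<bar>H x p\<bar> \<le> M * (1 + norm x) * (1 + norm p)"
    and convg: "convex_on UNIV g0"
  shows "(\<exists>u. fwd_inf H u \<and> u 0 = g0 \<and>
             (\<forall>v. fwd_inf H v \<and> v 0 = g0 \<longrightarrow> (\<forall>t\<ge>0. v t = u t)) \<and>
             bil_inf H u)
         \<and> (\<forall>T>0. reconstructible H T g0)"
proof -
  interpret convex_concave_hamiltonian H M
    by unfold_locales (fact convH concH M growth)+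
  obtain U where U: "continuous_on UNIV U" "\<And>x. U (0, x) = g0 x"
    and sup: "\<And>z d. z \<in> {0<..} \<times> UNIV \<Longrightarrow> d \<in> superdiff U z \<Longrightarrow> fst d + H (snd z) (snd d) = 0"
    and sub: "\<And>z d. z \<in> {0<..} \<times> UNIV \<Longrightarrow> d \<in> subdiff U z \<Longrightarrow> fst d + H (snd z) (snd d) = 0"
    using exists_bilateral_solution[OF convg] by metis
  define u where "u = (\<lambda>t x. U (t, x))"
  have uU: "(\<lambda>z. u (fst z) (snd z)) = U" unfolding u_def by simp
  \<comment> \<open>The equation holds as an equality on both differentials at all positive times,
    so \<open>u\<close> is a solution in either sense on every such domain.\<close>
  have fwd: "forward_visc H S D u" and bwd: "backward_visc H S D u" if "D \<subseteq> {0<..} \<times> UNIV" for S D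
    unfolding forward_visc_def backward_visc_def uU
    using continuous_on_subset[OF U(1)] sup sub that by (auto simp: subset_iff)
  have u0: "u 0 = g0" unfolding u_def using U(2) by simp
  have D_sub: "{0<..<T} \<times> (UNIV :: (real^'n) set) \<subseteq> {0<..} \<times> UNIV" for T :: real by auto
  have fwd_restrict: "fwd_T H T v" if "fwd_inf H v" for T v
  proof -
    have "{0..T} \<times> (UNIV :: (real^'n) set) \<subseteq> {0..} \<times> UNIV" by auto
    then show ?thesis using that D_sub[of T] unfolding forward_visc_def
      by (meson continuous_on_subset subsetD)
  qed
  \<comment> \<open>Uniqueness on the half-line is reduced to the horizon \<open>t + 1\<close>,
    which is positive even for \<open>t = 0\<close>.\<close>
  have "v t = u t" if "fwd_inf H v" "v 0 = g0" "t \<ge> 0" for v t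
    by (rule forward_visc_unique[OF fwd_restrict[OF that(1), of "t + 1"] fwd[OF D_sub]]) (use that u0 in auto)
  \<comment> \<open>The bilateral solution is its own backward solution: with final datum
    \<open>u T\<close>, uniqueness makes \<open>u\<close> the only candidate, and it returns to
    \<open>g0\<close>.\<close>
  moreover have "reconstructible H T g0" if T: "T > 0" for T
    unfolding reconstructible_def
  proof (intro exI conjI allI impI ballI)
    show "fwd_T H T u" "bwd_T H T u" by (intro fwd bwd D_sub)+
    show "u 0 = g0" "u 0 = g0" "u T = u T" using u0 by auto
    show "v t = u t" if "fwd_T H T v \<and> v 0 = g0" "t \<in> {0..T}" for v t
      by (rule forward_visc_unique[OF _ fwd[OF D_sub] _ that(2) T]) (use that u0 in auto)
    show "v t = u t" if "bwd_T H T v \<and> v T = u T" "t \<in> {0..T}" for v t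
      by (rule backward_visc_unique[OF _ bwd[OF D_sub] _ that(2) T]) (use that in auto)
  qed
  ultimately show ?thesis using fwd bwd u0 unfolding bilateral_visc_def by blast
qed

end
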